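(* Let $q$ be a prime power and $r\ge 2$ an integer. Fix an $\mathbb{F}_q$-basis $\{\beta_1,\dots,\beta_r\}$ of $\mathbb{F}_{q^r}$ and elements $c_1,\dots,c_r\in\mathbb{F}_q$, and let $\mathcal{C}=\{\mathcal{A}_1,\dots,\mathcal{A}_r\}$ where $\mathcal{A}_j=\{\sum_{i=1}^r a_i\beta_i : a_i\in\mathbb{F}_q,\ a_j=c_j\}$. Put $$\mathcal{S}_\mathcal{C}^\ast=\mathbb{F}_{q^r}\setminus\bigcup_{i=1}^r\mathcal{A}_i=\Big\{\sum_{i=1}^r a_i\beta_i : a_i\in\mathbb{F}_q,\ a_i\neq c_i \text{ for all } i\Big\}.$$ Then for every non-trivial multiplicative character $\chi$ of $\mathbb{F}_{q^r}$, $$\Big|\sum_{y\in\mathcal{S}_\mathcal{C}^\ast}\chi(y)\Big|\le \sqrt{3}\,(q-1)^{r/2}\,q^{\lceil 3r/4\rceil/2}.$$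
   Context: Multiplicative characters of $\mathbb{F}_{q^r}$ are homomorphisms $\mathbb{F}_{q^r}^\ast\to\mathbb{C}^\ast$, extended by $\chi(0)=0$. *)

theory Defs
  imports Complex_Main "HOL-Number_Theory.Prime_Powers"
begin

text \<open>
  A ring homomorphism between fields is automatically injective, so \<open>\<iota>\<close> below identifies the
  field \<open>'k\<close> with a subfield of \<open>'a\<close>; \<open>'a\<close> becomes a vector space over \<open>'k\<close> through
  \<open>c \<cdot> x = \<iota> c * x\<close>.
\<close>

definition field_embedding :: "('k::field \<Rightarrow> 'a::field) \<Rightarrow> bool" where
  "field_embedding \<iota> \<longleftrightarrow>
     \<iota> 1 = 1 \<and> (\<forall>x y. \<iota> (x + y) = \<iota> x + \<iota> y) \<and> (\<forall>x y. \<iota> (x * y) = \<iota> x * \<iota> y)"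

definition ext_scale :: "('k::field \<Rightarrow> 'a::field) \<Rightarrow> 'k \<Rightarrow> 'a \<Rightarrow> 'a" where
  "ext_scale \<iota> c x = \<iota> c * x"

lemma vector_space_ext_scale:
  assumes "field_embedding \<iota>"
  shows "vector_space (ext_scale \<iota>)"
  using assms
  by unfold_locales (auto simp: field_embedding_def ext_scale_def algebra_simps)

definition is_ext_basis :: "('k::field \<Rightarrow> 'a::field) \<Rightarrow> nat \<Rightarrow> (nat \<Rightarrow> 'a) \<Rightarrow> bool" where
  "is_ext_basis \<iota> r \<beta> \<longleftrightarrow>
     inj_on \<beta> {1..r} \<and>
     module.independent (ext_scale \<iota>) (\<beta> ` {1..r}) \<and>
     module.span (ext_scale \<iota>) (\<beta> ` {1..r}) = UNIV"

definition lin_comb :: "('k::field \<Rightarrow> 'a::field) \<Rightarrow> nat \<Rightarrow> (nat \<Rightarrow> 'a) \<Rightarrow> (nat \<Rightarrow> 'k) \<Rightarrow> 'a" where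
  "lin_comb \<iota> r \<beta> a = (\<Sum>i = 1..r. ext_scale \<iota> (a i) (\<beta> i))"

definition coord_hyperplane ::
    "('k::field \<Rightarrow> 'a::field) \<Rightarrow> nat \<Rightarrow> (nat \<Rightarrow> 'a) \<Rightarrow> (nat \<Rightarrow> 'k) \<Rightarrow> nat \<Rightarrow> 'a set" where
  "coord_hyperplane \<iota> r \<beta> c j = {lin_comb \<iota> r \<beta> a | a. a j = c j}"

definition missing_digits ::
    "('k::field \<Rightarrow> 'a::field) \<Rightarrow> nat \<Rightarrow> (nat \<Rightarrow> 'a) \<Rightarrow> (nat \<Rightarrow> 'k) \<Rightarrow> 'a set" where
  "missing_digits \<iota> r \<beta> c = UNIV - (\<Union>j\<in>{1..r}. coord_hyperplane \<iota> r \<beta> c j)"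

lemma lin_comb_exists:
  assumes \<iota>: "field_embedding \<iota>" and b: "is_ext_basis \<iota> r \<beta>"
  shows "\<exists>a. x = lin_comb \<iota> r \<beta> a"
proof -
  interpret vector_space "ext_scale \<iota>" by (rule vector_space_ext_scale[OF \<iota>])
  have inj: "inj_on \<beta> {1..r}" and "x \<in> span (\<beta> ` {1..r})"
    using b by (auto simp: is_ext_basis_def)
  then obtain u where "x = (\<Sum>v\<in>\<beta> ` {1..r}. ext_scale \<iota> (u v) v)"
    by (subst (asm) span_finite) auto
  then have "x = lin_comb \<iota> r \<beta> (u \<circ> \<beta>)"
    using inj by (simp add: lin_comb_def sum.reindex)
  then show ?thesis by blast
qed

lemma lin_comb_unique:
  assumes \<iota>: "field_embedding \<iota>" and b: "is_ext_basis \<iota> r \<beta>"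
    and eq: "lin_comb \<iota> r \<beta> a = lin_comb \<iota> r \<beta> a'" and i: "i \<in> {1..r}"
  shows "a i = a' i"
proof -
  interpret vector_space "ext_scale \<iota>" by (rule vector_space_ext_scale[OF \<iota>])
  have inj: "inj_on \<beta> {1..r}" and ind: "independent (\<beta> ` {1..r})"
    using b by (auto simp: is_ext_basis_def)
  define u where "u v = a (the_inv_into {1..r} \<beta> v) - a' (the_inv_into {1..r} \<beta> v)" for v
  have u: "u (\<beta> j) = a j - a' j" if "j \<in> {1..r}" for j
    using the_inv_into_f_f[OF inj that] by (simp add: u_def)
  have "(\<Sum>v\<in>\<beta> ` {1..r}. ext_scale \<iota> (u v) v) = (\<Sum>j = 1..r. ext_scale \<iota> (a j - a' j) (\<beta> j))"
    using inj u by (simp add: sum.reindex)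
  also have "\<dots> = 0"
    using eq by (simp add: lin_comb_def scale_left_diff_distrib sum_subtractf)
  finally have "u (\<beta> i) = 0"
    using independentD[OF ind, of "\<beta> ` {1..r}" u "\<beta> i"] i by auto
  then show ?thesis using u[OF i] by simp
qed

lemma missing_digits_eq:
  assumes "field_embedding \<iota>" and "is_ext_basis \<iota> r \<beta>"
  shows "missing_digits \<iota> r \<beta> c = {lin_comb \<iota> r \<beta> a | a. \<forall>i\<in>{1..r}. a i \<noteq> c i}"
proof (intro equalityI subsetI)
  fix x assume x: "x \<in> missing_digits \<iota> r \<beta> c"
  obtain a where a: "x = lin_comb \<iota> r \<beta> a" using lin_comb_exists[OF assms] by blast
  show "x \<in> {lin_comb \<iota> r \<beta> a | a. \<forall>i\<in>{1..r}. a i \<noteq> c i}"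
    using x a by (auto simp: missing_digits_def coord_hyperplane_def)
next
  fix x assume "x \<in> {lin_comb \<iota> r \<beta> a | a. \<forall>i\<in>{1..r}. a i \<noteq> c i}"
  then obtain a where x: "x = lin_comb \<iota> r \<beta> a" and a: "\<And>i. i \<in> {1..r} \<Longrightarrow> a i \<noteq> c i"
    by blast
  have "x \<notin> coord_hyperplane \<iota> r \<beta> c j" if j: "j \<in> {1..r}" for j
  proof
    assume "x \<in> coord_hyperplane \<iota> r \<beta> c j"
    then obtain a' where "x = lin_comb \<iota> r \<beta> a'" and c: "a' j = c j"
      unfolding coord_hyperplane_def by blast
    then have "a j = a' j" using x by (intro lin_comb_unique[OF assms _ j]) simp
    then show False using a[OF j] c by simp
  qed
  then show "x \<in> missing_digits \<iota> r \<beta> c"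
    by (simp add: missing_digits_def)
qed

definition mult_character :: "('a::field \<Rightarrow> complex) \<Rightarrow> bool" where
  "mult_character \<chi> \<longleftrightarrow>
     \<chi> 0 = 0 \<and> (\<forall>x. x \<noteq> 0 \<longrightarrow> \<chi> x \<noteq> 0) \<and>
     (\<forall>x y. x \<noteq> 0 \<longrightarrow> y \<noteq> 0 \<longrightarrow> \<chi> (x * y) = \<chi> x * \<chi> y)"

definition nontrivial_character :: "('a::field \<Rightarrow> complex) \<Rightarrow> bool" where
  "nontrivial_character \<chi> \<longleftrightarrow> (\<exists>x. x \<noteq> 0 \<and> \<chi> x \<noteq> 1)"

end

theory Submission
  imports
    "HOL-Algebra.Algebraic_Closure_Type"
    "HOL-Number_Theory.Cong"
    Defs
begin

text \<open>
  Let \<open>m = \<lceil>3 * r / 4\<rceil>\<close> and write the elements of the set as \<open>a + b\<close>, where \<open>a\<close> collects the first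
  \<open>m\<close> coordinates. By Cauchy-Schwarz, with \<open>a\<close> afterwards ranging over the whole subspace \<open>V\<close> of
  dimension \<open>m\<close>, it suffices to bound the sums of \<open>\<chi> (a + b) * cnj (\<chi> (a + b'))\<close> over \<open>a \<in> V\<close>. The
  diagonal \<open>b = b'\<close> contributes \<open>q ^ m\<close>; for \<open>b \<noteq> b'\<close> one completes the sum with additive characters
  and needs Weil's bound \<open>2 * sqrt (q ^ r)\<close> for the sums of \<open>\<chi> ((x + \<delta>) / x) * \<psi> x\<close>.

  Weil's bound is proved by elementary means. The \<open>L\<close>-series of the sum is a polynomial of degree at
  most two, so the sums over the extensions of degree \<open>m\<close> are \<open>- (w1 ^ m + w2 ^ m)\<close>. The
  Stepanov-Bombieri method bounds these sums, added up over the additive characters, by a constant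
  times the square root of the size of the extension field; this forces \<open>cmod wi \<le> sqrt (q ^ r)\<close>.
\<close>

section \<open>Stepanov's method\<close>

text \<open>Once common factors are taken out, Cauchy-Schwarz leaves \<open>q ^ m\<close> from the
  diagonal and at most \<open>q ^ (r - m) * 2 * sqrt (q ^ r)\<close> from the other pairs, because
  \<open>b\<close> takes at most \<open>q ^ (r - m)\<close> values. The condition
  \<open>3 * r \<le> 4 * m\<close> makes the second part at most \<open>2 * q ^ m\<close>, and the
  total \<open>3 * q ^ m\<close> is the origin of \<open>sqrt 3\<close>. In Weil's bound the
  obstacle is \<psi>, since Stepanov's method only counts points. Adding the sums for all characters
  \<open>\<psi> (t * x)\<close> leaves the elements of trace zero, which have the form
  \<open>z ^ Q - z\<close>, and turns the total into a sum of \<chi> over norms of a rational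
  function of \<open>z\<close>. For each value of the norm the method bounds the number of arguments
  from above. The method works over a field with \<open>P ^ 2\<close> elements, where
  \<open>P\<close> is a power of \<open>Q\<close>, so only extensions of even degree are
  estimated.\<close>

lemma nontrivial_poly_relation:
  fixes v :: "'u \<Rightarrow> 'b::field poly"
  assumes "finite U" and "n < card U"
    and "\<And>u k. u \<in> U \<Longrightarrow> n \<le> k \<Longrightarrow> coeff (v u) k = 0"
  shows "\<exists>c. (\<exists>u\<in>U. c u \<noteq> 0) \<and> (\<Sum>u\<in>U. smult (c u) (v u)) = 0"
  using assms
proof (induction n arbitrary: U v)
  case 0
  then have "v u = 0" if "u \<in> U" for u
    using that by (auto simp: poly_eq_iff)
  moreover have "U \<noteq> {}" using 0 by auto
  ultimately show ?case by (intro exI[of _ "\<lambda>_. 1"]) auto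
next
  case (Suc n)
  show ?case
  proof (cases "\<exists>u0\<in>U. coeff (v u0) n \<noteq> 0")
    case False
    then have "coeff (v u) k = 0" if "u \<in> U" "n \<le> k" for u k
      using that Suc.prems(3)[of u k] by (cases "k = n") auto
    then show ?thesis using Suc.IH[of U v] Suc.prems by auto
  next
    case True
    then obtain u0 where u0: "u0 \<in> U" "coeff (v u0) n \<noteq> 0" by blast
    \<comment> \<open>Gaussian elimination with pivot \<open>u0\<close>: the \<open>v' u\<close>
      have no coefficient of index \<open>n\<close>, and undoing the reduction forces the value
      \<open>c' u0\<close>.\<close>
    define r where "r u = coeff (v u) n / coeff (v u0) n" for u
    define v' where "v' u = v u - smult (r u) (v u0)" for u
    define U' where "U' = U - {u0}"
    have "coeff (v' u) k = 0" if "u \<in> U'" "n \<le> k" for u k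
      using that u0 Suc.prems(3)[of u k] Suc.prems(3)[of u0 k]
      by (cases "k = n") (auto simp: U'_def v'_def r_def)
    moreover have "n < card U'" "finite U'"
      using Suc.prems u0 by (auto simp: U'_def)
    ultimately obtain c where c: "\<exists>u\<in>U'. c u \<noteq> 0" "(\<Sum>u\<in>U'. smult (c u) (v' u)) = 0"
      using Suc.IH[of U' v'] by blast
    define c' where "c' = c(u0 := - (\<Sum>u\<in>U'. c u * r u))"
    have "(\<Sum>u\<in>U. smult (c' u) (v u)) = smult (c' u0) (v u0) + (\<Sum>u\<in>U'. smult (c' u) (v u))"
      using u0 Suc.prems by (simp add: U'_def sum.remove)
    also have "(\<Sum>u\<in>U'. smult (c' u) (v u)) = (\<Sum>u\<in>U'. smult (c u) (v' u) + smult (c u * r u) (v u0))"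
      by (intro sum.cong) (auto simp: c'_def v'_def U'_def smult_diff_right)
    also have "\<dots> = (\<Sum>u\<in>U'. smult (c u * r u) (v u0))"
      using c by (simp add: sum.distrib)
    also have "\<dots> = smult (\<Sum>u\<in>U'. c u * r u) (v u0)"
      by (simp add: smult_sum)
    finally have "(\<Sum>u\<in>U. smult (c' u) (v u)) = 0" by (simp add: c'_def)
    moreover have "\<exists>u\<in>U. c' u \<noteq> 0" using c(1) by (auto simp: c'_def U'_def)
    ultimately show ?thesis by blast
  qed
qed

text \<open>The largest degree that occurs with a nonzero coefficient occurs only once and cannot
  cancel. In Stepanov's method this shows that the auxiliary polynomial is not zero.\<close>

lemma sum_smult_distinct_degree_nonzero:
  fixes w :: "'u \<Rightarrow> 'b::field poly"
  assumes U: "finite U" and inj: "inj_on (\<lambda>u. degree (w u)) U"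
    and w: "\<And>u. u \<in> U \<Longrightarrow> w u \<noteq> 0" and c: "\<exists>u\<in>U. c u \<noteq> 0"
  shows "(\<Sum>u\<in>U. smult (c u) (w u)) \<noteq> 0"
proof -
  define U' where "U' = {u\<in>U. c u \<noteq> 0}"
  have U': "finite U'" "U' \<noteq> {}" using U c by (auto simp: U'_def)
  define D where "D = Max ((\<lambda>u. degree (w u)) ` U')"
  have "D \<in> (\<lambda>u. degree (w u)) ` U'" unfolding D_def using U' by (intro Max_in) auto
  then obtain u where u: "u \<in> U'" "degree (w u) = D" by auto
  have le: "degree (w u') \<le> D" if "u' \<in> U'" for u'
    unfolding D_def using U' that by (intro Max_ge) auto
  have zero: "c u' * coeff (w u') D = 0" if "u' \<in> U" "u' \<noteq> u" for u'
  proof (cases "c u' = 0")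
    case False
    then have u': "u' \<in> U'" using that by (simp add: U'_def)
    have "degree (w u') \<noteq> D" using inj u that by (auto simp: U'_def inj_on_def)
    then have "degree (w u') < D" using le[OF u'] by simp
    then show ?thesis by (simp add: coeff_eq_0)
  qed simp
  have "coeff (\<Sum>u\<in>U. smult (c u) (w u)) D = (\<Sum>u'\<in>U. c u' * coeff (w u') D)"
    by (simp add: coeff_sum)
  also have "\<dots> = c u * coeff (w u) D"
    using zero u U by (subst sum.remove[of U u]) (auto simp: U'_def intro!: sum.neutral simp del: mult_eq_0_iff)
  also have "\<dots> \<noteq> 0" using u w by (auto simp: U'_def)
  finally show ?thesis by auto
qed

lemma card_poly_roots_le:
  fixes f :: "'b::field poly"
  assumes "f \<noteq> 0" and "\<And>x. x \<in> Z \<Longrightarrow> poly f x = 0"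
  shows "finite Z" and "card Z \<le> degree f"
proof -
  have sub: "Z \<subseteq> {x. poly f x = 0}" using assms by auto
  show "finite Z" using finite_subset[OF sub poly_roots_finite[OF assms(1)]] .
  show "card Z \<le> degree f"
    using card_mono[OF poly_roots_finite[OF assms(1)] sub] card_poly_roots_bound[OF assms(1)] by simp
qed

text \<open>
  Bombieri's version of Stepanov's method: \<open>\<Psi>\<close> below is chosen so that its \<open>P\<close>-th power,
  evaluated at a point fixed by the \<open>P\<^sup>2\<close>-power Frobenius map at which \<open>(A / B) ^ n = u\<close>, is up to a
  nonzero factor the value of a combination \<open>\<Omega>\<close> of low degree, and \<open>\<Omega>\<close> vanishes identically
  because there are more coefficients than conditions.
\<close>

lemma stepanov_bound:
  fixes A B :: "'b::alg_closed_field poly"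
  assumes prime: "prime CHAR('b)" and P: "P = CHAR('b) ^ e" and PM: "P = d * M + 1"
    and B: "B \<noteq> 0" "degree B = a" and A: "degree A = a + 1" and large: "2 * a + 5 \<le> P"
    and Z: "Z = {x. x ^ (P ^ 2) = x \<and> poly A x \<noteq> 0 \<and> poly B x \<noteq> 0 \<and>
                  poly A x ^ (M * (P + 1)) = u * poly B x ^ (M * (P + 1))}"
  shows "card Z \<le> (M + 2 * a + 3) * P"
proof -
  \<comment> \<open>\<open>K\<close> is chosen so that the \<open>K * (P - 1)\<close> free
    coefficients outnumber the \<open>n\<close> coefficients of \<Omega> to be cancelled. This
    amounts to \<open>2 * (M + a) < 3 * (P - 2)\<close>, which follows from
    \<open>M \<le> P - 1\<close> and \<open>large\<close>.\<close>
  define K where "K = M + a + 3"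
  define U where "U = {..<M} \<times> {..<K} \<times> {..<d}"
  define \<omega> where "\<omega> = (\<lambda>(i,k,l). smult (u ^ l) (monom 1 (i * P + k) * A ^ ((d - 1 - l) * M) * B ^ (l * M)))"
  define \<psi> where "\<psi> = (\<lambda>(i,k,l). monom 1 (i + k * P) * A ^ (l * M) * B ^ ((d - 1 - l) * M) :: 'b poly)"
  have M: "M > 0" "d > 0" using PM large by (auto intro: Nat.gr0I)
  have A0: "A \<noteq> 0" using A by auto
  have finU: "finite U" by (simp add: U_def)
  have cardU: "card U = K * (P - 1)" by (simp add: U_def PM algebra_simps)
  define n where "n = M * P + K + a * P"
  have deg_\<omega>: "degree (\<omega> x) < n" if "x \<in> U" for x
  proof -
    obtain i k l where x: "x = (i,k,l)" by (cases x)
    have ikl: "i < M" "k < K" "l < d" using that x by (auto simp: U_def)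
    have "degree (\<omega> x) \<le> degree (monom (1::'b) (i * P + k) * A ^ ((d - 1 - l) * M) * B ^ (l * M))"
      by (simp add: \<omega>_def x)
    also have "\<dots> = i * P + k + (d - 1 - l) * M * (a + 1) + l * M * a"
      using A0 B A by (simp add: degree_mult_eq degree_power_eq degree_monom_eq)
    also have "\<dots> \<le> i * P + k + ((d - 1 - l) * M + l * M) * (a + 1)"
      by (simp add: algebra_simps)
    also have "(d - 1 - l) * M + l * M = (d - 1) * M"
      using ikl by (simp flip: add_mult_distrib)
    also have "i * P + k + (d - 1) * M * (a + 1) \<le> i * P + k + (P - 1) * (a + 1)"
      using PM by (intro add_mono mult_mono) auto
    also have "\<dots> < n"
    proof -
      have "(i + 1) * P \<le> M * P" using ikl by (intro mult_right_mono) auto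
      moreover have "(P - 1) * (a + 1) \<le> a * P + P" by (simp add: algebra_simps)
      ultimately show ?thesis using ikl unfolding n_def by (simp add: algebra_simps)
    qed
    finally show ?thesis .
  qed
  have "M \<le> P - 1" using PM M by simp
  have "n < card U"
  proof -
    obtain P' where P': "P = P' + 2" using large by (intro that[of "P - 2"]) simp
    have "(M + a) * P' + 3 * P' > (M + a) * (P' + 2)"
      using \<open>M \<le> P - 1\<close> large P' by (simp add: algebra_simps)
    then have "K * P' > (M + a) * P" using P' by (simp add: K_def algebra_simps)
    then show ?thesis unfolding cardU n_def using P' by (simp add: algebra_simps)
  qed
  moreover have "coeff (\<omega> x) k = 0" if "x \<in> U" "n \<le> k" for x k
    using deg_\<omega>[OF that(1)] that by (intro coeff_eq_0) simp
  ultimately obtain c where c: "\<exists>x\<in>U. c x \<noteq> 0" "(\<Sum>x\<in>U. smult (c x) (\<omega> x)) = 0"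
    using nontrivial_poly_relation[OF finU, of n \<omega>] by blast
  have Ppos: "P > 0" using large by simp
  \<comment> \<open>The \<open>P\<close>-th power of \<Psi> raises its coefficients to the power
    \<open>P\<close> too, so they have to be \<open>P\<close>-th roots of the
    \<open>c x\<close>.\<close>
  have "\<forall>x. \<exists>y. y ^ P = c x" using nth_root_exists[OF Ppos] by blast
  then obtain c' where c': "\<And>x. c' x ^ P = c x" by metis
  define \<Psi> where "\<Psi> = (\<Sum>x\<in>U. smult (c' x) (\<psi> x))"
  \<comment> \<open>Because the degrees of \<open>A\<close> and \<open>B\<close> differ by one,
    \<open>l\<close> enters as \<open>l * M\<close>. Up to a constant, \<open>i\<close>,
    \<open>l\<close> and \<open>k\<close> are then the digits of the degree in a mixed radix system,
    so different indices give different degrees.\<close>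
  have deg_\<psi>: "degree (\<psi> (i,k,l)) = i + l * M + k * P + (d - 1) * M * a" if "(i,k,l) \<in> U" for i k l
  proof -
    have l: "l < d" using that by (auto simp: U_def)
    have "degree (\<psi> (i,k,l)) = i + k * P + l * M * (a + 1) + (d - 1 - l) * M * a"
      using A0 B A by (simp add: \<psi>_def degree_mult_eq degree_power_eq degree_monom_eq)
    also have "\<dots> = i + l * M + k * P + ((d - 1 - l) + l) * M * a"
      by (simp add: algebra_simps)
    also have "(d - 1 - l) + l = d - 1" using l by simp
    finally show ?thesis .
  qed
  have small: "i + l * M < P" if "i < M" "l < d" for i l
  proof -
    have "(l + 1) * M \<le> d * M" using that by (intro mult_right_mono) auto
    then show ?thesis using that PM by simp
  qed
  have "inj_on (\<lambda>x. degree (\<psi> x)) U"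
  proof (rule inj_onI)
    fix x y assume xy: "x \<in> U" "y \<in> U" "degree (\<psi> x) = degree (\<psi> y)"
    obtain i k l i' k' l' where [simp]: "x = (i,k,l)" "y = (i',k',l')" by (cases x, cases y)
    have U1: "(i,k,l) \<in> U" and U2: "(i',k',l') \<in> U" using xy by auto
    then have eq: "i + l * M + k * P = i' + l' * M + k' * P" using xy(3) by (simp add: deg_\<psi>)
    have s: "i + l * M < P" "i' + l' * M < P" and i: "i < M" "i' < M"
      using U1 U2 small by (auto simp: U_def)
    have "k = (i + l * M + k * P) div P" "k' = (i' + l' * M + k' * P) div P"
      using s by simp_all
    then have "k = k'" using eq by simp
    with eq have eq': "i + l * M = i' + l' * M" by simp
    have "l = (i + l * M) div M" "l' = (i' + l' * M) div M"
      using i by simp_all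
    then have "l = l'" using eq' by simp
    with eq' \<open>k = k'\<close> show "x = y" by simp
  qed
  moreover have "\<exists>x\<in>U. c' x \<noteq> 0" using c(1) c' Ppos by (metis power_0_left less_numeral_extra(3))
  moreover have "\<psi> x \<noteq> 0" for x using A0 B by (auto simp: \<psi>_def split: prod.splits)
  ultimately have \<Psi>0: "\<Psi> \<noteq> 0"
    unfolding \<Psi>_def by (intro sum_smult_distinct_degree_nonzero[OF finU]) auto
  have "degree \<Psi> \<le> (K + a) * P"
    unfolding \<Psi>_def
  proof (rule degree_sum_le[OF finU])
    fix x assume xU: "x \<in> U"
    obtain i k l where x: "x = (i,k,l)" by (cases x)
    have ikl: "i < M" "k < K" "l < d" using xU x by (auto simp: U_def)
    have "degree (smult (c' x) (\<psi> x)) \<le> i + l * M + k * P + (d - 1) * M * a"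
      using deg_\<psi> xU x by (metis degree_smult_le)
    also have "\<dots> \<le> P + k * P + a * P"
    proof -
      have "(d - 1) * M \<le> P" using PM by (simp add: diff_mult_distrib)
      then have "(d - 1) * M * a \<le> P * a" by (rule mult_right_mono) simp
      then show ?thesis using small[OF ikl(1,3)] by (simp add: algebra_simps)
    qed
    also have "\<dots> = (k + 1 + a) * P" by (simp add: algebra_simps)
    also have "\<dots> \<le> (K + a) * P" using ikl by (intro mult_right_mono) auto
    finally show "degree (smult (c' x) (\<psi> x)) \<le> (K + a) * P" .
  qed
  moreover have "poly \<Psi> \<alpha> = 0" if "\<alpha> \<in> Z" for \<alpha>
  proof -
    define A' B' N where "A' = poly A \<alpha>" "B' = poly B \<alpha>" "N = M * (P + 1)"
    have \<alpha>: "\<alpha> ^ (P ^ 2) = \<alpha>" "A' \<noteq> 0" "B' \<noteq> 0" "A' ^ N = u * B' ^ N"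
      using that by (auto simp: Z A'_B'_N_def)
    \<comment> \<open>At \<alpha> the powers \<open>A' ^ (l * M * P)\<close> and
      \<open>B' ^ (j * M * P)\<close> reduce to powers with denominators \<open>A' ^ (l * M)\<close>
      and \<open>B' ^ (j * M)\<close>. \<open>C\<close> has the common denominator and does not
      depend on the index.\<close>
    define C where "C = B' ^ (N * (d - 1)) / (A' * B') ^ ((d - 1) * M)"
    have N: "M * P = N - M" "M \<le> N" by (simp_all add: A'_B'_N_def)
    have term_eq: "poly (smult (c' x) (\<psi> x)) \<alpha> ^ P = C * poly (smult (c x) (\<omega> x)) \<alpha>" if "x \<in> U" for x
    proof -
      obtain i k l where x: "x = (i,k,l)" by (cases x)
      define j where "j = d - 1 - l"
      have dj: "d - 1 = l + j" using that x by (auto simp: U_def j_def)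
      have pw: "A' ^ (l * M * P) * A' ^ (l * M) = u ^ l * B' ^ (N * l)"
      proof -
        have "A' ^ (l * M * P) * A' ^ (l * M) = (A' ^ N) ^ l"
          by (simp add: A'_B'_N_def algebra_simps flip: power_add power_mult)
        then show ?thesis by (simp add: \<alpha>(4) power_mult_distrib power_mult)
      qed
      have pb: "B' ^ (j * M * P) * B' ^ (j * M) = B' ^ (N * j)"
        by (simp add: A'_B'_N_def algebra_simps flip: power_add power_mult)
      have "\<alpha> ^ ((i + k * P) * P) = \<alpha> ^ (i * P) * (\<alpha> ^ (P ^ 2)) ^ k"
        by (simp add: power_add power2_eq_square algebra_simps flip: power_mult)
      also have "\<dots> = \<alpha> ^ (i * P + k)" by (simp add: \<alpha> power_add)
      finally have pa: "\<alpha> ^ ((i + k * P) * P) = \<alpha> ^ (i * P + k)" .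
      have "poly (smult (c' x) (\<psi> x)) \<alpha> ^ P =
          c x * \<alpha> ^ (i * P + k) * A' ^ (l * M * P) * B' ^ (j * M * P)"
        by (simp add: x \<psi>_def poly_monom power_mult_distrib A'_B'_N_def j_def c' pa flip: power_mult)
      also have "\<dots> = c x * \<alpha> ^ (i * P + k) * (A' ^ (l * M * P) * A' ^ (l * M)) * (B' ^ (j * M * P) * B' ^ (j * M)) /
           (A' ^ (l * M) * B' ^ (j * M))"
        using \<alpha> by simp
      also have "\<dots> = c x * \<alpha> ^ (i * P + k) * u ^ l * B' ^ (N * (l + j)) / (A' ^ (l * M) * B' ^ (j * M))"
        unfolding pw pb by (simp add: power_add algebra_simps)
      also have "\<dots> = C * (c x * u ^ l * \<alpha> ^ (i * P + k) * A' ^ (j * M) * B' ^ (l * M))"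
        unfolding C_def dj using \<alpha>
        by (simp add: field_simps power_add power_mult_distrib)
      also have "\<dots> = C * poly (smult (c x) (\<omega> x)) \<alpha>"
        by (simp add: x \<omega>_def poly_monom A'_B'_N_def j_def mult_ac)
      finally show ?thesis .
    qed
    have "poly \<Psi> \<alpha> ^ P = (\<Sum>x\<in>U. poly (smult (c' x) (\<psi> x)) \<alpha>) ^ P"
      by (simp add: \<Psi>_def poly_sum)
    also have "\<dots> = (\<Sum>x\<in>U. poly (smult (c' x) (\<psi> x)) \<alpha> ^ P)"
      by (rule freshmans_dream_sum'[OF prime P])
    also have "\<dots> = C * poly (\<Sum>x\<in>U. smult (c x) (\<omega> x)) \<alpha>"
      unfolding poly_sum sum_distrib_left by (intro sum.cong term_eq refl)
    also have "\<dots> = 0" by (simp add: c)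
    finally show ?thesis using Ppos by simp
  qed
  ultimately have "card Z \<le> (K + a) * P"
    using card_poly_roots_le(2)[OF \<Psi>0, of Z] by (meson le_trans)
  moreover have "K + a = M + 2 * a + 3" by (simp add: K_def)
  ultimately show ?thesis by simp
qed

text \<open>Scale by some \<open>w i0\<close> of largest modulus \<open>R\<close> and suppose
  \<open>R > \<rho>\<close>. Summed over \<open>k < n\<close>, the power sums of \<open>v\<close>
  stay bounded by a geometric series. But each \<open>i\<close> with \<open>v i = 1\<close>, among
  them \<open>i0\<close>, contributes \<open>n\<close>, and every other \<open>i\<close> a geometric
  sum bounded in \<open>n\<close>; large \<open>n\<close> gives a contradiction.\<close>

lemma norm_le_of_power_sums:
  fixes w :: "'i \<Rightarrow> complex"
  assumes I: "finite I" and bound: "\<And>k. k0 \<le> k \<Longrightarrow> cmod (\<Sum>i\<in>I. w i ^ k) \<le> C * \<rho> ^ k"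
    and \<rho>: "0 \<le> \<rho>" and j: "j \<in> I"
  shows "cmod (w j) \<le> \<rho>"
proof (rule ccontr)
  assume "\<not> cmod (w j) \<le> \<rho>"
  define R where "R = Max ((\<lambda>i. cmod (w i)) ` I)"
  have le_R: "cmod (w i) \<le> R" if "i \<in> I" for i
    unfolding R_def using I that by (intro Max_ge) auto
  have "R \<in> (\<lambda>i. cmod (w i)) ` I" unfolding R_def using I j by (intro Max_in) auto
  then obtain i0 where i0: "i0 \<in> I" "cmod (w i0) = R" by auto
  have R: "\<rho> < R" "0 < R" using le_R[OF j] \<open>\<not> _\<close> \<rho> by auto
  define v where "v i = w i / w i0" for i
  define x where "x = \<rho> / R"
  have x: "0 \<le> x" "x < 1" using R \<rho> by (auto simp: x_def)
  have v: "cmod (v i) \<le> 1" if "i \<in> I" for i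
    using le_R[OF that] i0 R by (simp add: v_def norm_divide)
  have s1: "cmod (\<Sum>i\<in>I. v i ^ k) \<le> card I" for k
  proof -
    have "cmod (\<Sum>i\<in>I. v i ^ k) \<le> (\<Sum>i\<in>I. 1)"
      using v by (intro sum_norm_le) (simp add: norm_power power_le_one)
    then show ?thesis by simp
  qed
  have s2: "cmod (\<Sum>i\<in>I. v i ^ k) \<le> C * x ^ k" if "k0 \<le> k" for k
  proof -
    have "(\<Sum>i\<in>I. v i ^ k) = (\<Sum>i\<in>I. w i ^ k) / w i0 ^ k"
      by (simp add: v_def power_divide sum_divide_distrib)
    then have "cmod (\<Sum>i\<in>I. v i ^ k) = cmod (\<Sum>i\<in>I. w i ^ k) / R ^ k"
      using i0 by (simp add: norm_divide norm_power)
    also have "\<dots> \<le> C * \<rho> ^ k / R ^ k"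
      using bound[OF that] R by (intro divide_right_mono) auto
    finally show ?thesis by (simp add: x_def power_divide)
  qed
  have C: "0 \<le> \<bar>C\<bar> * x ^ k" for k using x by simp
  \<comment> \<open>Below \<open>k0\<close> the power sums are bounded trivially by
    \<open>card I\<close>; the rest form the geometric series.\<close>
  define B where "B = real k0 * card I + \<bar>C\<bar> * (1 / (1 - x))"
  have partial: "cmod (\<Sum>k<n. \<Sum>i\<in>I. v i ^ k) \<le> B" for n
  proof -
    have le: "cmod (\<Sum>i\<in>I. v i ^ k) \<le> (if k < k0 then card I else 0) + \<bar>C\<bar> * x ^ k" for k
    proof (cases "k < k0")
      case True then show ?thesis using s1[of k] C[of k] by simp
    next
      case False
      have "C * x ^ k \<le> \<bar>C\<bar> * x ^ k" using x by (intro mult_right_mono) auto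
      then show ?thesis using s2[of k] False by simp
    qed
    have "cmod (\<Sum>k<n. \<Sum>i\<in>I. v i ^ k) \<le> (\<Sum>k<n. (if k < k0 then card I else 0) + \<bar>C\<bar> * x ^ k)"
      by (intro sum_norm_le le)
    also have "\<dots> = (\<Sum>k<n. real (if k < k0 then card I else 0)) + \<bar>C\<bar> * (\<Sum>k<n. x ^ k)"
      by (simp add: sum.distrib sum_distrib_left)
    also have "(\<Sum>k<n. real (if k < k0 then card I else 0)) = (\<Sum>k\<in>{..<n} \<inter> {..<k0}. real (card I))"
      by (subst sum.inter_restrict) (auto intro!: sum.cong)
    also have "\<dots> \<le> (\<Sum>k<k0. real (card I))"
      by (intro sum_mono2) auto
    also have "(\<Sum>k<n. x ^ k) \<le> 1 / (1 - x)"
      using x by (simp add: sum_gp_strict divide_right_mono)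
    finally show ?thesis unfolding B_def by (simp add: mult_left_mono)
  qed
  define I1 where "I1 = {i\<in>I. v i = 1}"
  have I1: "finite I1" "i0 \<in> I1" using I i0 R by (auto simp: I1_def v_def)
  define B' where "B' = (\<Sum>i\<in>I - I1. 2 / cmod (1 - v i))"
  have large: "real n \<le> B + B'" for n
  proof -
    have "(\<Sum>k<n. \<Sum>i\<in>I. v i ^ k) = (\<Sum>i\<in>I. \<Sum>k<n. v i ^ k)" by (rule sum.swap)
    also have "\<dots> = (\<Sum>i\<in>I1. \<Sum>k<n. v i ^ k) + (\<Sum>i\<in>I - I1. \<Sum>k<n. v i ^ k)"
      using I by (intro sum.subset_diff[where B = I1, THEN trans]) (auto simp: I1_def add.commute)
    also have "(\<Sum>i\<in>I1. \<Sum>k<n. v i ^ k) = of_nat (card I1 * n)"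
      by (simp add: I1_def)
    finally have eq: "of_nat (card I1 * n) = (\<Sum>k<n. \<Sum>i\<in>I. v i ^ k) - (\<Sum>i\<in>I - I1. \<Sum>k<n. v i ^ k)"
      by simp
    have "cmod (\<Sum>i\<in>I - I1. \<Sum>k<n. v i ^ k) \<le> B'"
      unfolding B'_def
    proof (rule sum_norm_le)
      fix i assume i: "i \<in> I - I1"
      then have "v i \<noteq> 1" by (simp add: I1_def)
      then have "(\<Sum>k<n. v i ^ k) = (1 - v i ^ n) / (1 - v i)" by (simp add: sum_gp_strict)
      moreover have "cmod (1 - v i ^ n) \<le> 2"
        using norm_triangle_ineq4[of 1 "v i ^ n"] v[of i] i by (simp add: norm_power power_le_one order_trans)
      ultimately show "cmod (\<Sum>k<n. v i ^ k) \<le> 2 / cmod (1 - v i)"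
        by (simp add: norm_divide divide_right_mono)
    qed
    then have "cmod (of_nat (card I1 * n)) \<le> B + B'"
      unfolding eq using partial[of n] norm_triangle_ineq4 by (smt (verit))
    moreover have "real n \<le> real (card I1 * n)"
      using I1 by (metis card_gt_0_iff empty_iff le_add2 mult.commute mult_le_mono2 nat_mult_1_right of_nat_mono Suc_leI One_nat_def)
    ultimately show ?thesis by (metis norm_of_nat order_trans)
  qed
  obtain n :: nat where "B + B' < real n" using reals_Archimedean2 by blast
  then show False using large[of n] by simp
qed

section \<open>Finite subfields of an algebraically closed field\<close>

lemma monic_eq_prod_proots:
  fixes f :: "'b::alg_closed_field poly"
  assumes "f \<noteq> 0"
  shows "f = smult (lead_coeff f) (\<Prod>x\<in>#proots f. [:-x, 1:])" and "size (proots f) = degree f"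
proof -
  obtain A where A: "size A = degree f" "f = smult (lead_coeff f) (\<Prod>x\<in>#A. [:-x, 1:])"
    using alg_closed_imp_factorization[OF assms] by blast
  have nz: "(\<Prod>x\<in>#A. [:-x, 1:]) \<noteq> 0" for A :: "'b multiset"
    by (induction A) (simp_all del: mult_pCons_left)
  have "proots f = proots (\<Prod>x\<in>#A. [:-x, 1:])"
    using A(2) assms by (metis proots_smult leading_coeff_0_iff)
  also have "\<dots> = A"
  proof (induction A)
    case (add x A)
    have "proots ([:-x, 1:] * (\<Prod>x\<in>#A. [:-x, 1:])) = {#x#} + proots (\<Prod>x\<in>#A. [:-x, 1:])"
      by (subst proots_mult[OF _ nz]) simp_all
    then show ?case using add by simp
  qed simp
  finally show "f = smult (lead_coeff f) (\<Prod>x\<in>#proots f. [:-x, 1:])" "size (proots f) = degree f"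
    using A by auto
qed

lemma dvd_iff_proots_subset:
  fixes f g :: "'b::alg_closed_field poly"
  assumes "f \<noteq> 0" "g \<noteq> 0"
  shows "f dvd g \<longleftrightarrow> proots f \<subseteq># proots g"
proof
  assume "f dvd g"
  then show "proots f \<subseteq># proots g" using assms by (auto elim!: dvdE simp: proots_mult)
next
  assume "proots f \<subseteq># proots g"
  then obtain r where r: "proots g = proots f + r" by (metis mset_subset_eq_exists_conv)
  have "g = smult (lead_coeff g) ((\<Prod>x\<in>#proots f. [:-x, 1:]) * (\<Prod>x\<in>#r. [:-x, 1:]))"
    using monic_eq_prod_proots(1)[OF assms(2)] by (simp add: r)
  moreover have "(\<Prod>x\<in>#proots f. [:-x, 1:]) dvd (\<Prod>x\<in>#proots f. [:-x, 1:]) * (\<Prod>x\<in>#r. [:-x, 1:])"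
    by simp
  ultimately show "f dvd g"
    using assms by (metis monic_eq_prod_proots(1) dvd_smult smult_dvd leading_coeff_0_iff)
qed

lemma card_roots_eq_degree:
  fixes f :: "'b::alg_closed_field poly"
  assumes "f \<noteq> 0" and "\<And>x. poly f x = 0 \<Longrightarrow> poly (pderiv f) x \<noteq> 0"
  shows "card {x. poly f x = 0} = degree f"
proof -
  have "count (proots f) x = 1" if "x \<in> set_mset (proots f)" for x
  proof -
    have x: "poly f x = 0" using that assms(1) by simp
    have "\<not> [:-x, 1:] ^ 2 dvd f"
    proof
      assume "[:-x, 1:] ^ 2 dvd f"
      then obtain g where "f = [:-x, 1:] ^ 2 * g" by (elim dvdE)
      then have "f = [:-x, 1:] * ([:-x, 1:] * g)" by (simp only: power2_eq_square mult.assoc)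
      then have "poly (pderiv f) x = 0" by (simp add: pderiv_mult del: mult_pCons_left)
      then show False using assms(2) x by blast
    qed
    then have "order x f < 2" using assms(1) by (auto simp: order_divides)
    moreover have "order x f > 0" using assms(1) x by (simp add: order_gt_0_iff)
    ultimately show ?thesis using assms(1) by simp
  qed
  then have "proots f = mset_set (set_mset (proots f))"
    by (intro multiset_eqI) (metis count_mset_set(1,3) finite_set_mset not_in_iff)
  then have "size (proots f) = card (set_mset (proots f))" by (metis size_mset_set)
  then show ?thesis using assms(1) monic_eq_prod_proots(2) by (metis set_count_proots)
qed

text \<open>Realising all extensions as subsets of one algebraically closed field lets their degree
  vary inside a proof, which a separate type for each extension would not allow.\<close>

locale frobenius =
  fixes Q :: nat and field_type :: "'b::alg_closed_field itself"
  assumes prime_char: "prime CHAR('b)" and Q_power: "\<exists>k>0. Q = CHAR('b) ^ k"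
begin

definition E :: "nat \<Rightarrow> 'b set" where "E m = {x. x ^ (Q ^ m) = x}"

abbreviation F :: "'b set" where "F \<equiv> E 1"

text \<open>On \<open>E m\<close> these are the trace and the norm down to \<open>F\<close>. As
  functions on the whole closure they satisfy telescoping identities such as
  \<open>tr_artin_schreier\<close> for every argument.\<close>

definition tr :: "nat \<Rightarrow> 'b \<Rightarrow> 'b" where "tr m x = (\<Sum>i<m. x ^ (Q ^ i))"

definition nm :: "nat \<Rightarrow> 'b \<Rightarrow> 'b" where "nm m x = (\<Prod>i<m. x ^ (Q ^ i))"

lemma Q_ge_2: "2 \<le> Q"
proof -
  obtain k where "k > 0" "Q = CHAR('b) ^ k" using Q_power by blast
  then show ?thesis using prime_ge_2_nat[OF prime_char] by (metis self_le_power order_trans le_trans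
    Suc_leI One_nat_def one_le_numeral)
qed

lemma Q_pos [simp]: "0 < Q" "Q \<noteq> 0" using Q_ge_2 by simp_all

lemma Q_pow_power: "\<exists>k. Q ^ m = CHAR('b) ^ k"
  using Q_power by (metis power_mult)

lemma frob_add: "(x + y :: 'b) ^ (Q ^ m) = x ^ (Q ^ m) + y ^ (Q ^ m)"
  using freshmans_dream'[OF prime_char] Q_pow_power by metis

lemma frob_sum: "(\<Sum>i\<in>A. f i :: 'b) ^ (Q ^ m) = (\<Sum>i\<in>A. f i ^ (Q ^ m))"
  using freshmans_dream_sum'[OF prime_char] Q_pow_power by metis

lemma frob_minus: "(- x :: 'b) ^ (Q ^ m) = - (x ^ (Q ^ m))"
proof -
  have "(- x + x) ^ (Q ^ m) = (- x) ^ (Q ^ m) + x ^ (Q ^ m)" by (rule frob_add)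
  then show ?thesis by (simp add: power_0_left eq_neg_iff_add_eq_0)
qed

lemma frob_diff: "(x - y :: 'b) ^ (Q ^ m) = x ^ (Q ^ m) - y ^ (Q ^ m)"
  using frob_add[of x "- y" m] by (simp add: frob_minus)

lemma frob_inj: "(x :: 'b) ^ (Q ^ m) = y ^ (Q ^ m) \<longleftrightarrow> x = y"
  using frob_diff[of x y m] by (metis Q_pos(1) zero_less_power eq_iff_diff_eq_0 power_eq_0_iff)

lemma frob_compose: "((x :: 'b) ^ (Q ^ i)) ^ (Q ^ j) = x ^ (Q ^ (i + j))"
  by (simp add: power_add flip: power_mult)

lemma E_0 [simp]: "0 \<in> E m" and E_1 [simp]: "1 \<in> E m"
  by (auto simp: E_def)

lemma E_closed:
  assumes "x \<in> E m" "y \<in> E m"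
  shows "x + y \<in> E m" "x - y \<in> E m" "x * y \<in> E m" "x / y \<in> E m"
  using assms by (auto simp: E_def frob_add frob_diff power_mult_distrib power_divide)

lemma E_uminus: "x \<in> E m \<Longrightarrow> - x \<in> E m"
  by (simp add: E_def frob_minus)

lemma E_power: "x \<in> E m \<Longrightarrow> x ^ n \<in> E m"
  by (induction n) (auto intro: E_closed)

lemma E_sum: "(\<And>i. i \<in> A \<Longrightarrow> f i \<in> E m) \<Longrightarrow> sum f A \<in> E m"
  by (simp add: E_def frob_sum)

lemma F_subset_E: "F \<subseteq> E m"
proof -
  have "x ^ (Q ^ m) = x" if "x ^ Q = x" for x :: 'b
    using that by (induction m) (auto simp: power_mult)
  then show ?thesis by (auto simp: E_def)
qed

lemma E_mult_index:
  assumes "x \<in> E e" shows "x \<in> E (e * k)"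
proof (induction k)
  case (Suc k)
  have "x ^ (Q ^ (e * Suc k)) = (x ^ (Q ^ (e * k))) ^ (Q ^ e)"
    unfolding frob_compose by (simp add: add.commute)
  then show ?case using Suc assms by (simp add: E_def)
qed (simp add: E_def)

lemma CHAR_dvd_Q_pow: "0 < m \<Longrightarrow> CHAR('b) dvd Q ^ m"
  using Q_power by (metis dvd_power dvd_power_same dvd_trans power_one_right dvd_refl)

text \<open>The derivative is the constant \<open>- 1\<close>, so no root is multiple. The case
  \<open>x = 0\<close> counts \<open>E m\<close>; the case \<open>m = 1\<close> gives the size of
  the fibres of \<open>z ^ Q - z\<close>.\<close>

lemma card_artin_schreier:
  assumes "0 < m"
  shows "card {z :: 'b. z ^ (Q ^ m) - z = x} = Q ^ m" and "finite {z :: 'b. z ^ (Q ^ m) - z = x}"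
proof -
  define N where "N = Q ^ m"
  have N: "1 < N" using assms Q_ge_2 self_le_power[of Q m] by (simp add: N_def)
  define f where "f = monom 1 N + [:- x, - 1:]"
  have deg: "degree f = N"
    unfolding f_def using N by (subst degree_add_eq_left) (simp_all add: degree_monom_eq)
  then have f0: "f \<noteq> 0" using N by auto
  have "of_nat N = (0 :: 'b)"
    using CHAR_dvd_Q_pow[OF assms] by (simp add: N_def of_nat_eq_0_iff_char_dvd del: of_nat_power)
  then have "pderiv f = - 1"
    by (simp add: f_def pderiv_add pderiv_monom pderiv_pCons one_pCons)
  then have "card {z. poly f z = 0} = N"
    using card_roots_eq_degree[OF f0] deg by simp
  moreover have eq: "{z. poly f z = 0} = {z. z ^ N - z = x}"
    by (auto simp: f_def poly_monom algebra_simps)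
  ultimately show "card {z :: 'b. z ^ (Q ^ m) - z = x} = Q ^ m" by (simp add: N_def)
  show "finite {z :: 'b. z ^ (Q ^ m) - z = x}"
    using poly_roots_finite[OF f0] eq by (simp add: N_def)
qed

lemma card_E: "0 < m \<Longrightarrow> card (E m) = Q ^ m" and finite_E: "0 < m \<Longrightarrow> finite (E m)"
  using card_artin_schreier[of m 0] by (auto simp: E_def)

text \<open>The power \<open>Q\<close> shifts the conjugates by one place and exchanges the factor
  \<open>x\<close> for \<open>x ^ (Q ^ m)\<close>. For nonzero \<open>x \<in> E m\<close> these
  cancel, so the norm is fixed by Frobenius.\<close>

lemma nm_eq: "nm m x * x ^ (Q ^ m) = x * nm m x ^ Q"
proof (induction m)
  case (Suc m)
  have "nm (Suc m) x * x ^ (Q ^ Suc m) = (nm m x * x ^ (Q ^ m)) * (x ^ (Q ^ m)) ^ Q"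
    by (simp add: nm_def mult.commute[of Q] flip: power_mult)
  also have "\<dots> = x * nm (Suc m) x ^ Q"
    unfolding Suc by (simp add: nm_def power_mult_distrib)
  finally show ?case .
qed (simp add: nm_def)

lemma nm_eq_0_iff [simp]: "0 < m \<Longrightarrow> nm m x = 0 \<longleftrightarrow> x = 0"
  by (auto simp: nm_def)

lemma nm_in_F: "x \<in> E m \<Longrightarrow> nm m x \<in> F"
  using nm_eq[of m x] by (cases "x = 0") (auto simp: E_def nm_def power_0_left)

lemma nm_power: "nm m x = x ^ (\<Sum>i<m. Q ^ i)"
  by (simp add: nm_def power_sum)

lemma tr_frob: "tr m x ^ Q = tr m x + x ^ (Q ^ m) - x"
proof (induction m)
  case (Suc m)
  have "tr (Suc m) x ^ Q = tr m x ^ Q + (x ^ (Q ^ m)) ^ Q"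
    using frob_add[of "tr m x" "x ^ (Q ^ m)" 1] by (simp add: tr_def)
  also have "\<dots> = tr (Suc m) x + x ^ (Q ^ Suc m) - x"
    unfolding Suc by (simp add: tr_def mult.commute[of Q] flip: power_mult)
  finally show ?case .
qed (simp add: tr_def)

lemma tr_in_F: "x \<in> E m \<Longrightarrow> tr m x \<in> F"
  using tr_frob[of m x] by (simp add: E_def)

lemma tr_mult_F:
  assumes "t \<in> F" shows "tr m (t * x) = t * tr m x"
proof -
  have "t ^ (Q ^ i) = t" for i using assms F_subset_E[of i] by (auto simp: E_def)
  then show ?thesis by (simp add: tr_def sum_distrib_left power_mult_distrib)
qed

lemma tr_add: "tr m (x + y) = tr m x + tr m y"
  by (simp add: tr_def frob_add sum.distrib)

lemma tr_artin_schreier: "tr m (z ^ Q - z) = z ^ (Q ^ m) - z"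
proof -
  have "tr m (z ^ Q - z) = (\<Sum>i<m. z ^ (Q ^ Suc i) - z ^ (Q ^ i))"
    by (simp add: tr_def frob_diff flip: power_mult)
  also have "\<dots> = z ^ (Q ^ m) - z"
    using sum_lessThan_telescope[of "\<lambda>i. z ^ (Q ^ i)" m] by (simp del: power_Suc)
  finally show ?thesis .
qed

end

section \<open>Polynomials over the ground field and characteristic polynomials\<close>

context frobenius
begin

definition Fr :: "'b poly \<Rightarrow> 'b poly" where "Fr f = map_poly (\<lambda>c. c ^ Q) f"

definition monics :: "nat \<Rightarrow> 'b poly set" where
  "monics n = {f. degree f = n \<and> lead_coeff f = 1 \<and> (\<forall>i. coeff f i \<in> F)}"

text \<open>For \<open>x \<in> E m\<close> this is the characteristic polynomial of \<open>x\<close>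
  over \<open>F\<close>, a power of the minimal polynomial. These polynomials take the place of the
  monic irreducible ones in an Euler product.\<close>

definition char_poly :: "nat \<Rightarrow> 'b \<Rightarrow> 'b poly" where
  "char_poly m x = (\<Prod>i<m. [:- (x ^ (Q ^ i)), 1:])"

lemma coeff_Fr: "coeff (Fr f) n = coeff f n ^ Q"
  by (simp add: Fr_def coeff_map_poly)

lemma Fr_mult: "Fr (f * g) = Fr f * Fr g"
proof (rule poly_eqI)
  fix n
  show "coeff (Fr (f * g)) n = coeff (Fr f * Fr g) n"
    using frob_sum[of "\<lambda>i. coeff f i * coeff g (n - i)" "{..n}" 1]
    by (simp add: coeff_Fr coeff_mult power_mult_distrib)
qed

lemma Fr_1 [simp]: "Fr 1 = 1"
  by (simp add: poly_eq_iff coeff_Fr)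

lemma Fr_power: "Fr (f ^ k) = Fr f ^ k"
  by (induction k) (auto simp: Fr_mult)

lemma Fr_prod: "Fr (\<Prod>i\<in>A. f i) = (\<Prod>i\<in>A. Fr (f i))"
  by (induction A rule: infinite_finite_induct) (auto simp: Fr_mult)

lemma Fr_linear: "Fr [:- x, 1:] = [:- (x ^ Q), 1:]"
  using frob_minus[of x 1] by (simp add: poly_eq_iff coeff_Fr coeff_pCons split: nat.splits)

lemma Fr_eq_iff: "Fr f = f \<longleftrightarrow> (\<forall>i. coeff f i \<in> F)"
  by (simp add: poly_eq_iff coeff_Fr E_def)

lemma poly_Fr: "Fr f = f \<Longrightarrow> poly f (x ^ Q) = poly f x ^ Q"
proof -
  assume "Fr f = f"
  then have "coeff f i ^ Q = coeff f i" for i by (metis coeff_Fr)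
  then show ?thesis
    using frob_sum[of "\<lambda>i. coeff f i * x ^ i" "{..degree f}" 1]
    by (simp add: poly_altdef power_mult_distrib mult.commute[of _ Q] flip: power_mult)
qed

lemma monics_nonzero: "f \<in> monics n \<Longrightarrow> f \<noteq> 0"
  by (auto simp: monics_def)

lemma monics_Fr: "f \<in> monics n \<Longrightarrow> Fr f = f"
  by (simp add: monics_def Fr_eq_iff)

lemma monics_iff: "f \<in> monics n \<longleftrightarrow> degree f = n \<and> lead_coeff f = 1 \<and> Fr f = f"
  unfolding monics_def Fr_eq_iff by blast

lemma monics_mult:
  assumes f: "f \<in> monics m" and g: "g \<in> monics n"
  shows "f * g \<in> monics (m + n)"
  unfolding monics_iff
proof (intro conjI)
  show "degree (f * g) = m + n"
    using f g monics_nonzero[OF f] monics_nonzero[OF g] by (simp add: degree_mult_eq monics_iff)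
  have "lead_coeff f = 1" "lead_coeff g = 1" using f g unfolding monics_iff by blast+
  then show "lead_coeff (f * g) = 1" unfolding lead_coeff_mult by simp
  show "Fr (f * g) = f * g" unfolding Fr_mult using f g by (simp add: monics_Fr)
qed

lemma monics_dvd:
  assumes f: "f \<in> monics m" and fg: "f * g \<in> monics n"
  shows "m \<le> n" and "g \<in> monics (n - m)"
proof -
  have nz: "f \<noteq> 0" "g \<noteq> 0" using monics_nonzero[OF fg] by auto
  have "f * Fr g = f * g" using monics_Fr[OF fg] monics_Fr[OF f] by (simp add: Fr_mult)
  then have "Fr g = g" using nz by simp
  moreover have "lead_coeff f = 1" "lead_coeff (f * g) = 1" using f fg unfolding monics_iff by blast+
  then have "lead_coeff g = 1" unfolding lead_coeff_mult by simp
  moreover have "m + degree g = n" using f fg nz by (simp add: monics_iff degree_mult_eq)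
  ultimately show "m \<le> n" "g \<in> monics (n - m)" by (auto simp: monics_iff)
qed

lemma degree_char_poly: "degree (char_poly m x) = m"
  and lead_coeff_char_poly: "lead_coeff (char_poly m x) = 1"
  and char_poly_nonzero: "char_poly m x \<noteq> 0"
proof -
  show *: "lead_coeff (char_poly m x) = 1" by (simp add: char_poly_def lead_coeff_prod)
  then show "char_poly m x \<noteq> 0" by auto
  show "degree (char_poly m x) = m" by (simp add: char_poly_def degree_prod_eq_sum_degree)
qed

text \<open>Frobenius on coefficients sends each linear factor to the next, and
  \<open>x \<in> E m\<close> closes the cycle, so the product is fixed.\<close>

lemma char_poly_monic:
  assumes "x \<in> E m" shows "char_poly m x \<in> monics m"
proof -
  define g where "g i = [:- (x ^ (Q ^ i)), 1:]" for i
  have "(\<Prod>i<m. g i) * g m = g 0 * (\<Prod>i<m. g (Suc i))"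
    using prod.lessThan_Suc[of g m] prod.lessThan_Suc_shift[of g m] by simp
  moreover have "g m = g 0" using assms by (simp add: g_def E_def)
  moreover have "g 0 \<noteq> 0" by (simp add: g_def)
  ultimately have "(\<Prod>i<m. g i) = (\<Prod>i<m. g (Suc i))" by (simp add: mult.commute)
  moreover have "Fr (g i) = g (Suc i)" for i
    unfolding g_def Fr_linear by (simp add: mult.commute[of Q] flip: power_mult)
  ultimately have "Fr (\<Prod>i<m. g i) = (\<Prod>i<m. g i)"
    unfolding Fr_prod by simp
  then show ?thesis
    using lead_coeff_char_poly[of m x]
    unfolding monics_iff degree_char_poly by (simp add: char_poly_def g_def)
qed

lemma finite_monics: "finite (monics n)"
proof (rule finite_subset)
  show "monics n \<subseteq> Poly ` {xs. set xs \<subseteq> F \<and> length xs = Suc n}"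
  proof
    fix f assume f: "f \<in> monics n"
    have "f = Poly (coeffs f)" by simp
    moreover have "length (coeffs f) = Suc n"
      using f monics_nonzero[OF f] by (simp add: length_coeffs_degree monics_def)
    moreover have "set (coeffs f) \<subseteq> F"
      using f by (auto simp: monics_def coeffs_def split: if_splits)
    ultimately show "f \<in> Poly ` {xs. set xs \<subseteq> F \<and> length xs = Suc n}" by blast
  qed
  show "finite (Poly ` {xs. set xs \<subseteq> F \<and> length xs = Suc n})"
    using finite_lists_length_eq[OF finite_E[of 1]] by simp
qed

lemma order_Frobenius:
  assumes "Fr f = f" "f \<noteq> 0"
  shows "order x f \<le> order (x ^ (Q ^ i)) f"
proof (induction i)
  case (Suc i)
  define y where "y = x ^ (Q ^ i)"
  have "[:- y, 1:] ^ order y f dvd f" by (rule order_1)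
  then have "Fr ([:- y, 1:] ^ order y f) dvd Fr f" by (metis Fr_mult dvd_def)
  then have "[:- (y ^ Q), 1:] ^ order y f dvd f" by (simp add: Fr_power Fr_linear assms)
  then have "order y f \<le> order (y ^ Q) f" using assms by (simp add: order_divides)
  then show ?case using Suc by (simp add: y_def mult.commute[of Q] flip: power_mult)
qed simp

lemma prod_lessThan_add:
  fixes g :: "nat \<Rightarrow> 'c::comm_monoid_mult"
  shows "(\<Prod>i<a + b. g i) = (\<Prod>i<a. g i) * (\<Prod>i<b. g (a + i))"
  by (induction b) (auto simp: mult.assoc)

lemma char_poly_power:
  assumes "x \<in> E e" shows "char_poly (e * k) x = char_poly e x ^ k"
proof (induction k)
  case (Suc k)
  have per: "x ^ (Q ^ (e * k + i)) = x ^ (Q ^ i)" for i k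
  proof (induction k)
    case (Suc k)
    have "x ^ (Q ^ (e * Suc k + i)) = (x ^ (Q ^ e)) ^ (Q ^ (e * k + i))"
      by (simp add: power_add algebra_simps flip: power_mult)
    then show ?case using Suc assms by (simp add: E_def)
  qed simp
  have "char_poly (e * Suc k) x = (\<Prod>i<e * k + e. [:- (x ^ (Q ^ i)), 1:])"
    by (simp add: char_poly_def add.commute)
  also have "\<dots> = char_poly (e * k) x * (\<Prod>i<e. [:- (x ^ (Q ^ (e * k + i))), 1:])"
    by (simp only: char_poly_def prod_lessThan_add)
  finally show ?case by (simp add: per Suc char_poly_def[of e])
qed (simp add: char_poly_def)

text \<open>Let \<open>e\<close> be the degree of \<open>x\<close> over \<open>F\<close>. Membership
  in \<open>E m\<close> means \<open>m = e * k\<close>, and then \<open>char_poly m x\<close> is the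
  \<open>k\<close>-th power of the minimal polynomial. Conjugates of \<open>x\<close> are roots of
  at least the same multiplicity, so this power divides \<open>f\<close> exactly for
  \<open>k \<le> order x f\<close>.\<close>

lemma card_char_poly_dvd_root:
  assumes f: "f \<in> monics n" and x: "poly f x = 0"
  shows "card {m\<in>{1..n}. x \<in> E m \<and> char_poly m x dvd f} = order x f"
proof -
  have f0: "f \<noteq> 0" and fr: "Fr f = f" using monics_nonzero[OF f] monics_Fr[OF f] .
  have root: "poly f (x ^ (Q ^ i)) = 0" for i
  proof (induction i)
    case (Suc i)
    then show ?case using poly_Fr[OF fr, of "x ^ (Q ^ i)"] by (simp add: mult.commute[of Q] flip: power_mult)
  qed (simp add: x)
  \<comment> \<open>The Frobenius orbit of \<open>x\<close> consists of roots of \<open>f\<close>,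
    hence is finite, which puts \<open>x\<close> into some \<open>E e\<close> with positive
    \<open>e\<close>.\<close>
  have "\<not> inj (\<lambda>i. x ^ (Q ^ i))"
  proof
    assume inj: "inj (\<lambda>i. x ^ (Q ^ i))"
    have "range (\<lambda>i. x ^ (Q ^ i)) \<subseteq> {y. poly f y = 0}" using root by auto
    then show False
      using finite_subset[OF _ poly_roots_finite[OF f0]] range_inj_infinite[OF inj] by blast
  qed
  then obtain i j where "i < j" "x ^ (Q ^ i) = x ^ (Q ^ j)"
    unfolding inj_def by (metis linorder_neqE_nat)
  then have "x ^ (Q ^ i) = (x ^ (Q ^ (j - i))) ^ (Q ^ i)" by (simp add: frob_compose)
  then have "x = x ^ (Q ^ (j - i))" by (simp only: frob_inj)
  then have "x \<in> E (j - i)" by (simp add: E_def)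
  then have "\<exists>e>0. x \<in> E e" using \<open>i < j\<close> by (intro exI[of _ "j - i"]) simp
  define e where "e = (LEAST e. e > 0 \<and> x \<in> E e)"
  have e: "e > 0" "x \<in> E e" using LeastI_ex[OF \<open>\<exists>e>0. x \<in> E e\<close>] by (auto simp: e_def)
  have least: "e \<le> m" if "m > 0" "x \<in> E m" for m
    unfolding e_def using that by (intro Least_le) auto
  have inj: "inj_on (\<lambda>i. x ^ (Q ^ i)) {..<e}"
  proof (rule linorder_inj_onI)
    fix i j assume ij: "i < j" "i \<in> {..<e}" "j \<in> {..<e}"
    show "x ^ (Q ^ i) \<noteq> x ^ (Q ^ j)"
    proof
      assume "x ^ (Q ^ i) = x ^ (Q ^ j)"
      then have "x ^ (Q ^ i) = (x ^ (Q ^ (j - i))) ^ (Q ^ i)" using ij by (simp add: frob_compose)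
      then have "x \<in> E (j - i)" unfolding frob_inj E_def by simp
      then show False using least[of "j - i"] ij by auto
    qed
  qed auto
  have e_dvd: "e dvd m" if "x \<in> E m" for m
  proof -
    have "x ^ (Q ^ m) = (x ^ (Q ^ (e * (m div e)))) ^ (Q ^ (m mod e))"
      unfolding frob_compose by simp
    then have "x \<in> E (m mod e)" using that by (simp add: E_mult_index[OF e(2), unfolded E_def, simplified] E_def)
    then have "m mod e = 0" using least[of "m mod e"] mod_less_divisor[OF e(1), of m] by linarith
    then show ?thesis by auto
  qed
  have proots: "proots (char_poly e x) = mset_set ((\<lambda>i. x ^ (Q ^ i)) ` {..<e})"
  proof -
    have "proots (char_poly e x) = image_mset (\<lambda>i. x ^ (Q ^ i)) (mset_set {..<e})"
      unfolding char_poly_def by (subst proots_prod) (auto simp: sum_unfold_sum_mset)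
    then show ?thesis using image_mset_mset_set[OF inj] by simp
  qed
  have dvd: "char_poly (e * k) x dvd f \<longleftrightarrow> k \<le> order x f" for k
  proof -
    have "char_poly (e * k) x dvd f \<longleftrightarrow> repeat_mset k (proots (char_poly e x)) \<subseteq># proots f"
      using dvd_iff_proots_subset[of "char_poly e x ^ k" f] f0
      by (simp add: char_poly_power[OF e(2)] proots_power char_poly_nonzero)
    also have "\<dots> \<longleftrightarrow> (\<forall>i<e. k \<le> order (x ^ (Q ^ i)) f)"
      unfolding subseteq_mset_def proots using f0 by (auto simp: count_mset_set')
    also have "\<dots> \<longleftrightarrow> k \<le> order x f"
    proof
      assume "\<forall>i<e. k \<le> order (x ^ (Q ^ i)) f"
      then have "k \<le> order (x ^ (Q ^ 0)) f" using e(1) by blast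
      then show "k \<le> order x f" by simp
    next
      assume "k \<le> order x f"
      then show "\<forall>i<e. k \<le> order (x ^ (Q ^ i)) f" using order_Frobenius[OF fr f0, of x] le_trans by blast
    qed
    finally show ?thesis .
  qed
  have "{m\<in>{1..n}. x \<in> E m \<and> char_poly m x dvd f} = (\<lambda>k. e * k) ` {1..order x f}"
  proof (intro equalityI subsetI)
    fix m assume m: "m \<in> {m\<in>{1..n}. x \<in> E m \<and> char_poly m x dvd f}"
    then obtain k where "m = e * k" using e_dvd by blast
    then show "m \<in> (\<lambda>k. e * k) ` {1..order x f}" using m dvd[of k] by (cases "k = 0") auto
  next
    fix m assume "m \<in> (\<lambda>k. e * k) ` {1..order x f}"
    then obtain k where k: "m = e * k" "k \<in> {1..order x f}" by blast
    have d: "char_poly m x dvd f" using dvd[of k] k by simp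
    have "x \<in> E m" unfolding k(1) by (rule E_mult_index[OF e(2)])
    moreover have "m \<le> n"
      using dvd_imp_degree_le[OF d f0] f by (simp add: degree_char_poly monics_def)
    ultimately show "m \<in> {m\<in>{1..n}. x \<in> E m \<and> char_poly m x dvd f}"
      using d k e by (auto simp: Suc_le_eq)
  qed
  moreover have "inj_on (\<lambda>k. e * k) {1..order x f}" using e by (auto simp: inj_on_def)
  ultimately show ?thesis by (simp add: card_image)
qed

text \<open>Counting the pairs of \<open>m\<close> and \<open>x\<close> by \<open>x\<close> gives
  the sum of the multiplicities of all roots. Writing the degree in this way yields the logarithmic
  derivative of the L-series without any factorisation into irreducibles.\<close>

lemma sum_card_char_poly_dvd:
  assumes f: "f \<in> monics n"
  shows "(\<Sum>m=1..n. card {x \<in> E m. char_poly m x dvd f}) = n"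
proof -
  have f0: "f \<noteq> 0" using monics_nonzero[OF f] .
  define R where "R = {x. poly f x = 0}"
  have finR: "finite R" using poly_roots_finite[OF f0] by (simp add: R_def)
  have root: "x \<in> R" if "1 \<le> m" "char_poly m x dvd f" for m x
  proof -
    have "[:- (x ^ (Q ^ 0)), 1:] dvd char_poly m x"
      unfolding char_poly_def
      using that dvd_prodI[of "{..<m}" 0 "\<lambda>i. [:- (x ^ (Q ^ i)), 1:]"] by simp
    then have "[:- x, 1:] dvd char_poly m x" by simp
    then have "[:- x, 1:] dvd f" using that(2) dvd_trans by blast
    then show ?thesis by (simp add: R_def poly_eq_0_iff_dvd)
  qed
  have "(\<Sum>m=1..n. card {x \<in> E m. char_poly m x dvd f}) =
        (\<Sum>m=1..n. \<Sum>x\<in>R. if x \<in> E m \<and> char_poly m x dvd f then 1 else 0)"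
  proof (rule sum.cong[OF refl])
    fix m assume m: "m \<in> {1..n}"
    have "{x \<in> E m. char_poly m x dvd f} = {x\<in>R. x \<in> E m \<and> char_poly m x dvd f}"
      using root m by auto
    then show "card {x \<in> E m. char_poly m x dvd f} = (\<Sum>x\<in>R. if x \<in> E m \<and> char_poly m x dvd f then 1 else 0)"
      using finR by (simp add: sum.If_cases Int_def)
  qed
  also have "\<dots> = (\<Sum>x\<in>R. \<Sum>m=1..n. if x \<in> E m \<and> char_poly m x dvd f then 1 else 0)"
    by (rule sum.swap)
  also have "\<dots> = (\<Sum>x\<in>R. card {m\<in>{1..n}. x \<in> E m \<and> char_poly m x dvd f})"
    by (simp add: sum.If_cases Int_def)
  also have "\<dots> = (\<Sum>x\<in>R. count (proots f) x)"
    using card_char_poly_dvd_root[OF f] f0 by (simp add: R_def)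
  also have "\<dots> = size (proots f)"
    using f0 by (simp add: size_multiset_overloaded_eq R_def)
  also have "\<dots> = n" using monic_eq_prod_proots(2)[OF f0] f by (simp add: monics_def)
  finally show ?thesis .
qed

end

section \<open>The \<open>L\<close>-series and Weil's bound\<close>

locale character_pair = frobenius Q field_type
  for Q :: nat and field_type :: "'b::alg_closed_field itself" +
  fixes \<chi> \<psi> :: "'b \<Rightarrow> complex" and \<delta> :: 'b
  assumes \<chi>_0 [simp]: "\<chi> 0 = 0"
    and \<chi>_mult: "x \<in> F \<Longrightarrow> y \<in> F \<Longrightarrow> \<chi> (x * y) = \<chi> x * \<chi> y"
    and \<chi>_nontrivial: "\<exists>x\<in>F. x \<noteq> 0 \<and> \<chi> x \<noteq> 1"
    and \<chi>_nonzero: "x \<in> F \<Longrightarrow> x \<noteq> 0 \<Longrightarrow> \<chi> x \<noteq> 0"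
    and \<psi>_0 [simp]: "\<psi> 0 = 1"
    and \<psi>_add: "x \<in> F \<Longrightarrow> y \<in> F \<Longrightarrow> \<psi> (x + y) = \<psi> x * \<psi> y"
    and \<delta>: "\<delta> \<in> F" "\<delta> \<noteq> 0"
begin

lemma \<chi>_1 [simp]: "\<chi> 1 = 1"
  using \<chi>_mult[of 1 1] \<chi>_nonzero[of 1] by simp

lemma sum_\<chi>: "(\<Sum>x\<in>F. \<chi> x) = 0"
proof -
  obtain a where a: "a \<in> F" "a \<noteq> 0" "\<chi> a \<noteq> 1" using \<chi>_nontrivial by blast
  have "(\<Sum>x\<in>F. \<chi> x) = (\<Sum>x\<in>F. \<chi> (a * x))"
    by (rule sum.reindex_bij_witness[of _ "\<lambda>x. a * x" "\<lambda>x. x / a"]) (use a in \<open>auto intro: E_closed\<close>)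
  also have "\<dots> = \<chi> a * (\<Sum>x\<in>F. \<chi> x)"
    using a by (simp add: \<chi>_mult sum_distrib_left)
  finally show ?thesis using a by simp
qed

lemma sum_\<chi>_affine:
  assumes "a \<in> F" "a \<noteq> 0" "b \<in> F"
  shows "(\<Sum>x\<in>F. \<chi> (a * x + b)) = 0"
proof -
  have "(\<Sum>x\<in>F. \<chi> (a * x + b)) = (\<Sum>x\<in>F. \<chi> x)"
    by (rule sum.reindex_bij_witness[of _ "\<lambda>x. (x - b) / a" "\<lambda>x. a * x + b"])
      (use assms in \<open>auto intro!: E_closed\<close>)
  then show ?thesis by (simp only: sum_\<chi>)
qed

text \<open>A multiplicative function on monic polynomials whose value at
  \<open>char_poly m x\<close> is the summand of \<open>S m\<close>: the argument of \<chi> is a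
  product over the roots and that of \<psi> is their sum. The reflected polynomial picks the
  coefficient below the leading one and gives 0 in degree 0.\<close>

definition weight :: "'b poly \<Rightarrow> complex" where
  "weight f = \<chi> (poly f (- \<delta>) / poly f 0) * \<psi> (- coeff (reflect_poly f) 1)"

definition L_coeff :: "nat \<Rightarrow> complex" where "L_coeff n = (\<Sum>f\<in>monics n. weight f)"

definition S :: "nat \<Rightarrow> complex" where
  "S m = (\<Sum>x\<in>E m. \<chi> (nm m ((x + \<delta>) / x)) * \<psi> (tr m x))"

lemma poly_in_F: "f \<in> monics n \<Longrightarrow> y \<in> F \<Longrightarrow> poly f y \<in> F"
  unfolding poly_altdef monics_def by (intro E_sum E_closed E_power) auto

lemma coeff_reflect_in_F: "f \<in> monics n \<Longrightarrow> coeff (reflect_poly f) i \<in> F"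
  by (auto simp: coeff_reflect_poly monics_def)

lemma coeff_1_reflect_mult:
  fixes f g :: "'b poly"
  assumes "lead_coeff f = 1" "lead_coeff g = 1"
  shows "coeff (reflect_poly (f * g)) 1 = coeff (reflect_poly f) 1 + coeff (reflect_poly g) (1::nat)"
  using assms by (simp add: reflect_poly_mult coeff_mult)

lemma weight_mult:
  assumes f: "f \<in> monics m" and g: "g \<in> monics n"
  shows "weight (f * g) = weight f * weight g"
proof -
  define a b where "a = - coeff (reflect_poly f) 1" "b = - coeff (reflect_poly g) 1"
  have ab: "a \<in> F" "b \<in> F"
    unfolding a_b_def using coeff_reflect_in_F[OF f] coeff_reflect_in_F[OF g] by (auto intro: E_uminus)
  have "- coeff (reflect_poly (f * g)) 1 = a + b"
    using f g by (subst coeff_1_reflect_mult) (auto simp: monics_def a_b_def)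
  moreover have "poly (f * g) (- \<delta>) / poly (f * g) 0 =
      (poly f (- \<delta>) / poly f 0) * (poly g (- \<delta>) / poly g 0)" by simp
  moreover have "- \<delta> \<in> F" using \<delta>(1) by (rule E_uminus)
  then have "poly f (- \<delta>) / poly f 0 \<in> F" "poly g (- \<delta>) / poly g 0 \<in> F"
    using poly_in_F[OF f] poly_in_F[OF g] by (auto intro!: E_closed)
  ultimately show ?thesis
    unfolding weight_def by (simp only: \<chi>_mult \<psi>_add ab flip: a_b_def) simp
qed

lemma coeff_1_reflect_char_poly: "coeff (reflect_poly (char_poly m x)) 1 = - tr m x"
proof (induction m)
  case (Suc m)
  have "char_poly (Suc m) x = char_poly m x * [:- (x ^ (Q ^ m)), 1:]"
    by (simp add: char_poly_def)
  then have "coeff (reflect_poly (char_poly (Suc m) x)) 1 = - tr m x + coeff (reflect_poly [:- (x ^ (Q ^ m)), 1:]) 1"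
    using coeff_1_reflect_mult[OF lead_coeff_char_poly, of "[:- (x ^ (Q ^ m)), 1:]" m x] Suc by simp
  then show ?case by (simp add: coeff_reflect_poly tr_def)
qed (simp add: char_poly_def tr_def)

lemma weight_char_poly: "weight (char_poly m x) = \<chi> (nm m ((x + \<delta>) / x)) * \<psi> (tr m x)"
proof -
  \<comment> \<open>At \<open>a = 0\<close> both sides are 0 by the convention for division.\<close>
  have "(- \<delta> - a) / (- a) = (a + \<delta>) / a" for a
    by (cases "a = 0") (auto simp: field_simps)
  moreover have "\<delta> ^ (Q ^ i) = \<delta>" for i using \<delta> F_subset_E[of i] by (auto simp: E_def)
  ultimately have "(- \<delta> - x ^ (Q ^ i)) / (- (x ^ (Q ^ i))) = ((x + \<delta>) / x) ^ (Q ^ i)" for i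
    by (simp only: power_divide frob_add)
  moreover have "poly [:- a, 1:] (- \<delta>) / poly [:- a, 1:] 0 = (- \<delta> - a) / (- a)" for a
    by simp
  ultimately have "poly (char_poly m x) (- \<delta>) / poly (char_poly m x) 0 = nm m ((x + \<delta>) / x)"
    unfolding char_poly_def poly_prod nm_def prod_dividef[symmetric] by (simp only:)
  then show ?thesis using coeff_1_reflect_char_poly[of m x] by (simp add: weight_def)
qed

lemma S_eq: "S m = (\<Sum>x\<in>E m. weight (char_poly m x))"
  by (simp add: S_def weight_char_poly)

lemma L_coeff_0: "L_coeff 0 = 1"
proof -
  have "monics 0 = {1}"
    by (auto simp: monics_iff elim!: degree_eq_zeroE) 
  then show ?thesis by (simp add: L_coeff_def weight_def)
qed

text \<open>Adding \<open>[:0, v:]\<close> changes the value at \<open>- \<delta>\<close> by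
  \<open>- \<delta> * v\<close> and keeps the value at 0; it keeps the coefficient of index
  \<open>n - 1\<close> as well, because \<open>n - 1 \<ge> 2\<close>. So if the value at 0 is
  nonzero, the weights along such a family are a fixed factor times the values of \<chi> on all of
  \<open>F\<close>, which sum to zero. Otherwise they all vanish.\<close>

lemma L_coeff_vanish:
  assumes "3 \<le> n" shows "L_coeff n = 0"
proof -
  have shift: "f + [:0, v:] \<in> monics n" "coeff (f + [:0, v:]) (n - 1) = coeff f (n - 1)" "degree (f + [:0, v:]) = n"
    if "f \<in> monics n" "v \<in> F" for f v
  proof -
    have "degree [:0, v:] < degree f"
      using that assms by (simp add: monics_def)
    then show deg: "degree (f + [:0, v:]) = n"
      using that by (simp add: degree_add_eq_left monics_def)
    have co: "coeff [:0, v:] i = (if i = 1 then v else 0)" for i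
      by (auto simp: coeff_pCons split: nat.splits)
    show "coeff (f + [:0, v:]) (n - 1) = coeff f (n - 1)" using assms co by simp
    have "coeff (f + [:0, v:]) n = 1"
      using assms that co by (auto simp: monics_def)
    moreover have "coeff (f + [:0, v:]) i \<in> F" for i
      unfolding coeff_add co using that by (auto simp: monics_def intro: E_closed)
    ultimately show "f + [:0, v:] \<in> monics n" using deg by (simp add: monics_def)
  qed
  \<comment> \<open>Averaging over all \<open>v\<close> replaces a choice of representatives for
    these families.\<close>
  have "of_nat Q * L_coeff n = (\<Sum>v\<in>F. L_coeff n)" using card_E[of 1] by simp
  also have "\<dots> = (\<Sum>v\<in>F. \<Sum>f\<in>monics n. weight (f + [:0, v:]))"
  proof (rule sum.cong[OF refl])
    fix v assume v: "v \<in> F"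
    have "- v \<in> F" using v by (rule E_uminus)
    then show "L_coeff n = (\<Sum>f\<in>monics n. weight (f + [:0, v:]))"
      unfolding L_coeff_def
      using shift(1)[OF _ v] shift(1)[of _ "- v"]
      by (intro sum.reindex_bij_witness[of _ "\<lambda>f. f + [:0, v:]" "\<lambda>f. f + [:0, - v:]"]) (auto simp: add.assoc)
  qed
  also have "\<dots> = (\<Sum>f\<in>monics n. \<Sum>v\<in>F. weight (f + [:0, v:]))" by (rule sum.swap)
  also have "\<dots> = (\<Sum>f\<in>monics n. 0)"
  proof (rule sum.cong[OF refl])
    fix f assume f: "f \<in> monics n"
    define A where "A = \<psi> (- coeff f (n - 1))"
    have w: "weight (f + [:0, v:]) = \<chi> (- \<delta> / poly f 0 * v + poly f (- \<delta>) / poly f 0) * A" if "v \<in> F" for v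
    proof -
      have "coeff (reflect_poly (f + [:0, v:])) 1 = coeff f (n - 1)"
        using shift[OF f that] assms by (simp add: coeff_reflect_poly)
      then show ?thesis by (simp add: weight_def A_def field_simps add_divide_distrib diff_divide_distrib)
    qed
    have "(\<Sum>v\<in>F. weight (f + [:0, v:])) = (\<Sum>v\<in>F. \<chi> (- \<delta> / poly f 0 * v + poly f (- \<delta>) / poly f 0)) * A"
      by (simp add: w sum_distrib_right)
    also have "(\<Sum>v\<in>F. \<chi> (- \<delta> / poly f 0 * v + poly f (- \<delta>) / poly f 0)) = 0"
    proof (cases "poly f 0 = 0")
      case False
      then show ?thesis using \<delta> poly_in_F[OF f] E_uminus[OF \<delta>(1)]
        by (intro sum_\<chi>_affine E_closed) auto
    qed simp
    finally show "(\<Sum>v\<in>F. weight (f + [:0, v:])) = 0" by simp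
  qed
  finally show ?thesis by simp
qed

text \<open>The logarithmic derivative of the \<open>L\<close>-series, compared coefficientwise.\<close>

lemma L_coeff_recursion: "of_nat n * L_coeff n = (\<Sum>m=1..n. L_coeff (n - m) * S m)"
proof -
  have "of_nat n * L_coeff n = (\<Sum>f\<in>monics n. of_nat (\<Sum>m=1..n. card {x \<in> E m. char_poly m x dvd f}) * weight f)"
    unfolding L_coeff_def sum_distrib_left by (intro sum.cong refl) (simp only: sum_card_char_poly_dvd)
  also have "\<dots> = (\<Sum>f\<in>monics n. \<Sum>m=1..n. \<Sum>x\<in>E m. if char_poly m x dvd f then weight f else 0)"
  proof (intro sum.cong refl)
    fix f
    have "of_nat (card {x \<in> E m. char_poly m x dvd f}) * weight f =
      (\<Sum>x\<in>E m. if char_poly m x dvd f then weight f else 0)" if "m \<in> {1..n}" for m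
      using that finite_E[of m] by (simp add: sum.If_cases Int_def)
    then show "of_nat (\<Sum>m=1..n. card {x \<in> E m. char_poly m x dvd f}) * weight f =
      (\<Sum>m=1..n. \<Sum>x\<in>E m. if char_poly m x dvd f then weight f else 0)"
      by (simp add: sum_distrib_right)
  qed
  also have "\<dots> = (\<Sum>m=1..n. \<Sum>f\<in>monics n. \<Sum>x\<in>E m. if char_poly m x dvd f then weight f else 0)"
    by (rule sum.swap)
  also have "\<dots> = (\<Sum>m=1..n. \<Sum>x\<in>E m. \<Sum>f\<in>monics n. if char_poly m x dvd f then weight f else 0)"
    by (intro sum.cong refl sum.swap)
  also have "\<dots> = (\<Sum>m=1..n. \<Sum>x\<in>E m. L_coeff (n - m) * weight (char_poly m x))"
  proof (intro sum.cong refl)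
    fix m x assume m: "m \<in> {1..n}" and x: "x \<in> E m"
    have cp: "char_poly m x \<in> monics m" using char_poly_monic[OF x] .
    have "(\<Sum>f\<in>monics n. if char_poly m x dvd f then weight f else 0) =
      (\<Sum>f\<in>{f\<in>monics n. char_poly m x dvd f}. weight f)"
      using finite_monics[of n] by (simp add: sum.If_cases Int_def)
    also have "{f\<in>monics n. char_poly m x dvd f} = (\<lambda>g. char_poly m x * g) ` monics (n - m)"
    proof (intro equalityI subsetI)
      fix f assume "f \<in> {f\<in>monics n. char_poly m x dvd f}"
      then obtain g where g: "f = char_poly m x * g" "char_poly m x * g \<in> monics n" by (auto elim!: dvdE)
      then show "f \<in> (\<lambda>g. char_poly m x * g) ` monics (n - m)" using monics_dvd(2)[OF cp g(2)] by blast
    next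
      fix f assume "f \<in> (\<lambda>g. char_poly m x * g) ` monics (n - m)"
      then obtain g where g: "f = char_poly m x * g" "g \<in> monics (n - m)" by blast
      then show "f \<in> {f\<in>monics n. char_poly m x dvd f}" using monics_mult[OF cp g(2)] m by simp
    qed
    also have "(\<Sum>f\<in>(\<lambda>g. char_poly m x * g) ` monics (n - m). weight f) =
      (\<Sum>g\<in>monics (n - m). weight (char_poly m x * g))"
      by (rule sum.reindex_cong[OF _ refl refl]) (auto simp: inj_on_def char_poly_nonzero)
    also have "\<dots> = L_coeff (n - m) * weight (char_poly m x)"
      unfolding L_coeff_def sum_distrib_right
      by (intro sum.cong refl) (simp only: weight_mult[OF cp] mult.commute[of "weight (char_poly m x)"])
    finally show "(\<Sum>f\<in>monics n. if char_poly m x dvd f then weight f else 0) = L_coeff (n - m) * weight (char_poly m x)" .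
  qed
  finally show ?thesis by (simp add: S_eq sum_distrib_left)
qed

text \<open>These are Newton's identities for the inverse roots of
  \<open>1 + c1 * u + c2 * u ^ 2 = (1 - w1 * u) * (1 - w2 * u)\<close>. From index 3 on the left
  side of \<open>L_coeff_recursion\<close> vanishes, and \<open>S\<close> obeys the linear
  recurrence whose characteristic roots are \<open>w1\<close> and \<open>w2\<close>.\<close>

lemma S_power_sum: "\<exists>w1 w2. \<forall>m\<ge>1. S m = - (w1 ^ m + w2 ^ m)"
proof -
  define c1 c2 where "c1 = L_coeff 1" "c2 = L_coeff 2"
  define s where "s = csqrt (c1\<^sup>2 - 4 * c2)"
  define w1 w2 where "w1 = (- c1 + s) / 2" "w2 = (- c1 - s) / 2"
  have s: "s\<^sup>2 = c1\<^sup>2 - 4 * c2" by (simp add: s_def)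
  have w: "w1 + w2 = - c1" "w1 * w2 = c2"
    using s by (simp_all add: w1_w2_def field_simps power2_eq_square)
  have quad: "x ^ Suc (Suc n) = - c1 * x ^ Suc n - c2 * x ^ n" if "x = w1 \<or> x = w2" for x n
  proof -
    have "(x - w1) * (x - w2) = 0" using that by auto
    then have "x * x = (w1 + w2) * x - w1 * w2" by (simp add: algebra_simps)
    then have "x * x = - c1 * x - c2" by (simp add: w)
    then have "x ^ n * (x * x) = x ^ n * (- c1 * x - c2)" by simp
    then show ?thesis by (simp add: algebra_simps)
  qed
  have S1: "S 1 = c1" using L_coeff_recursion[of 1] by (simp add: L_coeff_0 c1_c2_def)
  have S2: "S 2 = 2 * c2 - c1 * c1"
    using L_coeff_recursion[of 2] S1 by (simp add: L_coeff_0 c1_c2_def numeral_2_eq_2)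
  have S3: "S (n + 3) = - c1 * S (n + 2) - c2 * S (n + 1)" for n
  proof -
    have "0 = (\<Sum>m=1..n+3. L_coeff (n + 3 - m) * S m)"
      using L_coeff_recursion[of "n + 3"] L_coeff_vanish[of "n + 3"] by simp
    also have "\<dots> = (\<Sum>m\<in>{n+1,n+2,n+3}. L_coeff (n + 3 - m) * S m)"
    proof (rule sum.mono_neutral_right)
      show "\<forall>i\<in>{1..n + 3} - {n + 1, n + 2, n + 3}. L_coeff (n + 3 - i) * S i = 0"
        by (auto intro!: L_coeff_vanish)
    qed auto
    also have "\<dots> = c2 * S (n + 1) + c1 * S (n + 2) + S (n + 3)"
      by (simp add: c1_c2_def L_coeff_0 numeral_2_eq_2 numeral_3_eq_3)
    finally show ?thesis by (simp add: algebra_simps eq_neg_iff_add_eq_0)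
  qed
  have "S (Suc m) = - (w1 ^ Suc m + w2 ^ Suc m)" for m
  proof (induction m rule: less_induct)
    case (less m)
    consider "m = 0" | "m = 1" | n where "m = n + 2" by (metis One_nat_def add_2_eq_Suc' not0_implies_Suc)
    then show ?case
    proof cases
      case 1 then show ?thesis using S1 w by (simp add: neg_eq_iff_add_eq_0 add.commute)
    next
      case 2
      have "w1 ^ 2 + w2 ^ 2 = (w1 + w2) ^ 2 - 2 * (w1 * w2)" by (simp add: power2_eq_square algebra_simps)
      then show ?thesis using 2 S2 w by (simp add: power2_eq_square numeral_2_eq_2)
    next
      case 3
      have "S (Suc m) = - c1 * S (n + 2) - c2 * S (n + 1)" using S3[of n] 3 by (simp add: eval_nat_numeral)
      also have "S (n + 2) = - (w1 ^ Suc (Suc n) + w2 ^ Suc (Suc n))" using less[of "n + 1"] 3 by simp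
      also have "S (n + 1) = - (w1 ^ Suc n + w2 ^ Suc n)" using less[of n] 3 by simp
      finally have "S (Suc m) = c1 * w1 ^ Suc (Suc n) + c2 * w1 ^ Suc n + (c1 * w2 ^ Suc (Suc n) + c2 * w2 ^ Suc n)"
        by (simp add: algebra_simps del: power_Suc)
      moreover have "w ^ Suc m = - (c1 * w ^ Suc (Suc n) + c2 * w ^ Suc n)" if "w = w1 \<or> w = w2" for w
        using quad[OF that, of "Suc n"] 3 by (simp del: power_Suc)
      ultimately show ?thesis by (simp del: power_Suc)
    qed
  qed
  then have "\<forall>m\<ge>1. S m = - (w1 ^ m + w2 ^ m)" by (metis One_nat_def Suc_le_D)
  then show ?thesis by blast
qed

end

section \<open>Artin-Schreier substitution and Stepanov's bound for the total sum\<close>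

locale weil_sum = character_pair Q field_type \<chi> \<psi> \<delta>
  for Q :: nat and field_type :: "'b::alg_closed_field itself" and \<chi> \<psi> :: "'b \<Rightarrow> complex" and \<delta> :: 'b +
  assumes \<psi>_nontrivial: "\<exists>x\<in>F. \<psi> x \<noteq> 1"
begin

text \<open>Orthogonality in \<open>t\<close> involves the trivial character \<open>t = 0\<close>,
  so \<open>character_pair\<close> has to admit it; \<open>weil_sum\<close> asks for nontriviality
  of \<psi> itself only.\<close>

lemma character_pair_scaled: "t \<in> F \<Longrightarrow> character_pair Q \<chi> (\<lambda>x. \<psi> (t * x)) \<delta>"
  using \<chi>_mult \<chi>_nontrivial \<chi>_nonzero \<psi>_add \<delta>
  by unfold_locales (auto simp: distrib_left E_closed(3))

lemma norm_\<chi>: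
  assumes "x \<in> F" "x \<noteq> 0" shows "cmod (\<chi> x) = 1"
proof -
  have pow: "\<chi> (x ^ n) = \<chi> x ^ n" for n
  proof (induction n)
    case (Suc n)
    then show ?case using \<chi>_mult[OF assms(1) E_power[OF assms(1), of n]] by simp
  qed simp
  have "x * x ^ (Q - 1) = x"
    using assms Q_ge_2 by (simp add: E_def flip: power_Suc)
  then have "x ^ (Q - 1) = 1" using assms by simp
  then have "\<chi> x ^ (Q - 1) = 1" using pow[of "Q - 1"] by simp
  then show ?thesis using Q_ge_2 power_eq_1_iff[of "\<chi> x" "Q - 1"] by simp
qed

lemma sum_\<psi>_scaled:
  assumes "a \<in> F"
  shows "(\<Sum>t\<in>F. \<psi> (t * a)) = (if a = 0 then of_nat Q else 0)"
proof (cases "a = 0")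
  case True
  then show ?thesis using card_E[of 1] by simp
next
  case False
  obtain b where b: "b \<in> F" "\<psi> b \<noteq> 1" using \<psi>_nontrivial by blast
  have ba: "b / a \<in> F" using b assms by (intro E_closed)
  have "(\<Sum>t\<in>F. \<psi> (t * a)) = (\<Sum>t\<in>F. \<psi> ((t + b / a) * a))"
    by (rule sum.reindex_bij_witness[of _ "\<lambda>t. t + b / a" "\<lambda>t. t - b / a"])
      (use ba in \<open>auto intro: E_closed\<close>)
  also have "\<dots> = (\<Sum>t\<in>F. \<psi> (t * a) * \<psi> b)"
  proof (rule sum.cong[OF refl])
    fix t assume "t \<in> F"
    then have "t * a \<in> F" using assms by (intro E_closed)
    then show "\<psi> ((t + b / a) * a) = \<psi> (t * a) * \<psi> b"
      using False b by (simp add: distrib_right \<psi>_add)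
  qed
  also have "\<dots> = (\<Sum>t\<in>F. \<psi> (t * a)) * \<psi> b" by (simp add: sum_distrib_right)
  finally show ?thesis using b False by simp
qed

definition T :: "nat \<Rightarrow> complex" where
  "T m = (\<Sum>t\<in>F. \<Sum>x\<in>E m. \<chi> (nm m ((x + \<delta>) / x)) * \<psi> (t * tr m x))"

text \<open>Orthogonality in \<open>t\<close> keeps the \<open>x\<close> of trace zero, with weight
  \<open>Q\<close>. These are the values of \<open>z ^ Q - z\<close> on \<open>E m\<close>, each
  taken exactly \<open>Q\<close> times, so the sum over \<open>z\<close> absorbs the weight.\<close>

lemma T_eq_sum_E:
  assumes m: "0 < m"
  shows "T m = (\<Sum>z\<in>E m. \<chi> (nm m ((z ^ Q - z + \<delta>) / (z ^ Q - z))))"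
proof -
  define Y where "Y = {x\<in>E m. tr m x = 0}"
  define g where "g x = \<chi> (nm m ((x + \<delta>) / x))" for x
  have "T m = (\<Sum>x\<in>E m. \<Sum>t\<in>F. g x * \<psi> (t * tr m x))"
    unfolding T_def g_def by (rule sum.swap)
  also have "\<dots> = (\<Sum>x\<in>E m. if tr m x = 0 then of_nat Q * g x else 0)"
  proof (rule sum.cong[OF refl])
    fix x assume "x \<in> E m"
    then show "(\<Sum>t\<in>F. g x * \<psi> (t * tr m x)) = (if tr m x = 0 then of_nat Q * g x else 0)"
      using sum_\<psi>_scaled[OF tr_in_F] by (simp flip: sum_distrib_left)
  qed
  also have "\<dots> = (\<Sum>x\<in>Y. of_nat Q * g x)"
    using finite_E[OF m] by (simp add: Y_def sum.If_cases Int_def)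
  also have "\<dots> = (\<Sum>x\<in>Y. \<Sum>z\<in>{z\<in>E m. z ^ Q - z = x}. g (z ^ Q - z))"
  proof (rule sum.cong[OF refl])
    fix x assume x: "x \<in> Y"
    \<comment> \<open>All \<open>Q\<close> roots lie in \<open>E m\<close>, since
      \<open>z ^ (Q ^ m) - z\<close> is the trace of \<open>x\<close>, which is zero.\<close>
    have "{z\<in>E m. z ^ Q - z = x} = {z. z ^ Q - z = x}"
      using x tr_artin_schreier[of m] by (auto simp: Y_def E_def)
    then have "card {z\<in>E m. z ^ Q - z = x} = Q" using card_artin_schreier(1)[of 1 x] by simp
    then show "of_nat Q * g x = (\<Sum>z\<in>{z\<in>E m. z ^ Q - z = x}. g (z ^ Q - z))" by simp
  qed
  also have "\<dots> = (\<Sum>z\<in>E m. g (z ^ Q - z))"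
  proof (rule sum.group)
    show "finite (E m)" "finite Y" using finite_E[OF m] by (auto simp: Y_def)
    show "(\<lambda>z. z ^ Q - z) ` E m \<subseteq> Y"
    proof clarify
      fix z assume z: "z \<in> E m"
      then have "tr m (z ^ Q - z) = 0" by (simp add: tr_artin_schreier E_def)
      then show "z ^ Q - z \<in> Y" using E_closed(2)[OF E_power[OF z, of Q] z] by (simp add: Y_def)
    qed
  qed
  finally show ?thesis by (simp add: g_def)
qed

text \<open>Numerator and denominator of \<open>(z ^ Q - z + \<delta>) / (z ^ Q - z)\<close> after
  putting \<open>z = 1 / w\<close> and multiplying by \<open>w ^ Q\<close>. In \<open>z\<close> both
  have degree \<open>Q\<close>; in \<open>w\<close> the degrees differ by one, as
  \<open>stepanov_bound\<close> demands.\<close>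

definition A :: "'b poly" where "A = 1 - monom 1 (Q - 1) + monom \<delta> Q"
definition B :: "'b poly" where "B = 1 - monom 1 (Q - 1)"

lemma A_B: "degree B = Q - 1" "B \<noteq> 0" "degree A = Q - 1 + 1"
proof -
  have "degree (- monom 1 (Q - 1) + 1 :: 'b poly) = Q - 1"
    using Q_ge_2 by (subst degree_add_eq_left) (simp_all add: degree_monom_eq)
  then show B: "degree B = Q - 1" by (simp add: B_def)
  then show "B \<noteq> 0" using Q_ge_2 by auto
  have "degree (B + monom \<delta> Q) = Q"
    using B \<delta> Q_ge_2 by (subst degree_add_eq_right) (simp_all add: degree_monom_eq)
  then show "degree A = Q - 1 + 1" using Q_ge_2 by (simp add: A_def B_def)
qed

lemma poly_A_B: "poly A x = 1 - x ^ (Q - 1) + \<delta> * x ^ Q" "poly B x = 1 - x ^ (Q - 1)"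
  by (simp_all add: A_def B_def poly_monom)

lemma T_eq_sum_inverse:
  assumes m: "0 < m"
  shows "T m = (\<Sum>w\<in>E m - {0}. \<chi> (nm m (poly A w / poly B w)))"
proof -
  have nm0: "nm m 0 = 0" using m by simp
  \<comment> \<open>The term \<open>z = 0\<close> has denominator 0, so its quotient, norm and
    character value are all 0.\<close>
  have "T m = (\<Sum>z\<in>E m - {0}. \<chi> (nm m ((z ^ Q - z + \<delta>) / (z ^ Q - z))))"
    unfolding T_eq_sum_E[OF m] using finite_E[OF m] by (simp add: sum.remove[of "E m" 0] nm0 power_0_left)
  also have "\<dots> = (\<Sum>w\<in>E m - {0}. \<chi> (nm m (poly A w / poly B w)))"
  proof (rule sum.reindex_bij_witness[of _ "\<lambda>w. 1 / w" "\<lambda>z. 1 / z"])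
    fix z assume z: "z \<in> E m - {0}"
    define w where "w = 1 / z"
    have w: "w \<noteq> 0" "z = 1 / w" using z by (auto simp: w_def)
    have wQ: "w ^ Q = w * w ^ (Q - 1)" using Q_ge_2 by (simp flip: power_Suc)
    have "(z ^ Q - z) * w ^ Q = poly B w" "(z ^ Q - z + \<delta>) * w ^ Q = poly A w"
      using w(1) by (simp_all add: w(2) poly_A_B power_divide wQ field_simps)
    then have "poly A w / poly B w = (z ^ Q - z + \<delta>) / (z ^ Q - z)"
      using w by (metis mult_divide_mult_cancel_right power_not_zero)
    then show "\<chi> (nm m (poly A (1 / z) / poly B (1 / z))) = \<chi> (nm m ((z ^ Q - z + \<delta>) / (z ^ Q - z)))"
      by (simp add: w_def)
  qed (auto intro: E_closed)
  finally show ?thesis .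
qed

lemma sum_Q_power: "(Q - 1) * (\<Sum>i<e. Q ^ i) + 1 = Q ^ e"
proof (induction e)
  case (Suc e)
  have "(Q - 1) * (\<Sum>i<Suc e. Q ^ i) + 1 = ((Q - 1) * (\<Sum>i<e. Q ^ i) + 1) + (Q - 1) * Q ^ e"
    by (simp add: algebra_simps)
  also have "\<dots> = Q ^ e + (Q - 1) * Q ^ e" by (simp only: Suc)
  also have "\<dots> = (1 + (Q - 1)) * Q ^ e" by (simp only: add_mult_distrib mult_1)
  also have "1 + (Q - 1) = Q" using Q_ge_2 by simp
  finally show ?case by simp
qed simp

text \<open>Since \<chi> sums to zero over \<open>U\<close>, each count \<open>N u\<close> may be
  traded for the deficit \<open>D - N u\<close>, which Stepanov's bound makes nonnegative. The
  modulus is then at most the total deficit \<open>(Q - 1) * D - card W\<close>, in which the main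
  terms \<open>P ^ 2\<close> cancel.\<close>

lemma norm_T_le:
  assumes e: "3 \<le> e"
  shows "cmod (T (2 * e)) \<le> ((real Q - 1) * (2 * real Q + 1) + 2 * real Q) * real Q ^ e"
proof -
  define m P M where "m = 2 * e" "P = Q ^ e" "M = (\<Sum>i<e. Q ^ i)"
  have m: "0 < m" using e by (simp add: m_P_M_def)
  have PM: "P = (Q - 1) * M + 1" using sum_Q_power[of e] by (simp add: m_P_M_def)
  have P2: "P ^ 2 = Q ^ m" by (simp add: m_P_M_def mult.commute[of 2] power_mult)
  \<comment> \<open>The exponent \<open>M * (P + 1)\<close> is \<open>(Q ^ m - 1) / (Q - 1)\<close>.
    So with \<open>d = Q - 1\<close> the condition in \<open>stepanov_bound\<close> prescribes the
    norm of \<open>poly A w / poly B w\<close>.\<close>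
  have nm_M: "nm m y = y ^ (M * (P + 1))" for y
  proof -
    have "(Q - 1) * (\<Sum>i<m. Q ^ i) + 1 = (Q - 1) * (M * (P + 1)) + 1"
    proof -
      have "(Q - 1) * (M * (P + 1)) + 1 = (P - 1) * (P + 1) + 1"
        using PM by (metis mult.assoc diff_add_inverse2)
      also have "\<dots> = P ^ 2" using PM by (simp add: power2_eq_square algebra_simps)
      finally show ?thesis using sum_Q_power[of m] P2 by simp
    qed
    then have "(\<Sum>i<m. Q ^ i) = M * (P + 1)" using Q_ge_2 by simp
    then show ?thesis by (simp add: nm_power)
  qed
  \<comment> \<open>For \<open>Q = 2\<close> this fails at \<open>e = 2\<close>, hence the
    assumption \<open>3 \<le> e\<close>.\<close>
  have large: "2 * (Q - 1) + 5 \<le> P"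
  proof -
    have "4 * Q \<le> Q ^ 2 * Q" using power_mono[OF Q_ge_2, of 2] by (intro mult_right_mono) simp_all
    moreover have "Q ^ 2 * Q = Q ^ 3" by (simp add: power3_eq_cube power2_eq_square)
    moreover have "Q ^ 3 \<le> P"
      unfolding m_P_M_def using e Q_ge_2 by (intro power_increasing) linarith+
    ultimately have "4 * Q \<le> P" by linarith
    then show ?thesis using Q_ge_2 by linarith
  qed
  define N where "N u = card {w\<in>E m - {0}. nm m (poly A w / poly B w) = u}" for u
  define W where "W = {w\<in>E m - {0}. poly A w \<noteq> 0 \<and> poly B w \<noteq> 0}"
  define U where "U = F - {0}"
  have finU: "finite U" and cardU: "card U = Q - 1"
    using finite_E[of 1] card_E[of 1] by (simp_all add: U_def)
  have finE: "finite (E m)" using finite_E[OF m] .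
  obtain k where k: "P = CHAR('b) ^ k" using Q_pow_power[of e] by (auto simp: m_P_M_def)
  define D where "D = (M + 2 * (Q - 1) + 3) * P"
  have N_le: "N u \<le> D" if u: "u \<in> U" for u
  proof -
    define Z where "Z = {x. x ^ (P ^ 2) = x \<and> poly A x \<noteq> 0 \<and> poly B x \<noteq> 0 \<and>
      poly A x ^ (M * (P + 1)) = u * poly B x ^ (M * (P + 1))}"
    have Z: "card Z \<le> D"
      unfolding D_def by (rule stepanov_bound[OF prime_char k PM A_B(2,1,3) large Z_def])
    have "{w\<in>E m - {0}. nm m (poly A w / poly B w) = u} \<subseteq> Z"
    proof
      fix w assume "w \<in> {w\<in>E m - {0}. nm m (poly A w / poly B w) = u}"
      then have w: "w \<in> E m" "nm m (poly A w / poly B w) = u" by auto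
      have nz: "poly A w \<noteq> 0" "poly B w \<noteq> 0" using w(2) u m by (auto simp: U_def)
      have "poly A w ^ (M * (P + 1)) = u * poly B w ^ (M * (P + 1))"
        using w(2) nz unfolding nm_M by (simp add: power_divide field_simps)
      then show "w \<in> Z" using nz w(1) by (simp add: Z_def P2 E_def)
    qed
    moreover have "Z \<subseteq> E m" by (auto simp: Z_def P2 E_def)
    ultimately have "N u \<le> card Z" unfolding N_def using finE by (meson card_mono finite_subset)
    then show ?thesis using Z by simp
  qed
  have A_in: "poly A w \<in> E m" "poly B w \<in> E m" if "w \<in> E m" for w
    unfolding poly_A_B using that \<delta>(1) F_subset_E[of m] by (auto intro!: E_closed E_power)
  have partition: "(\<Sum>w\<in>W. f (nm m (poly A w / poly B w))) = (\<Sum>u\<in>U. of_nat (N u) * f u)"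
    for f :: "'b \<Rightarrow> complex"
  proof -
    have "(\<Sum>w\<in>W. f (nm m (poly A w / poly B w))) =
      (\<Sum>u\<in>U. \<Sum>w\<in>{w\<in>W. nm m (poly A w / poly B w) = u}. f (nm m (poly A w / poly B w)))"
    proof (rule sum.group[symmetric])
      show "finite W" using finE by (simp add: W_def)
      show "(\<lambda>w. nm m (poly A w / poly B w)) ` W \<subseteq> U"
        using m A_in by (auto simp: W_def U_def simp del: One_nat_def intro!: nm_in_F E_closed)
    qed (fact finU)
    also have "\<dots> = (\<Sum>u\<in>U. of_nat (N u) * f u)"
    proof (rule sum.cong[OF refl])
      fix u assume "u \<in> U"
      then have "{w\<in>W. nm m (poly A w / poly B w) = u} = {w\<in>E m - {0}. nm m (poly A w / poly B w) = u}"
        using m by (auto simp: W_def U_def)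
      then show "(\<Sum>w\<in>{w\<in>W. nm m (poly A w / poly B w) = u}. f (nm m (poly A w / poly B w))) = of_nat (N u) * f u"
        by (simp add: N_def)
    qed
    finally show ?thesis .
  qed
  have nm0: "nm m 0 = 0" using m by simp
  have "T m = (\<Sum>w\<in>W. \<chi> (nm m (poly A w / poly B w)))"
    unfolding T_eq_sum_inverse[OF m] W_def using finE by (intro sum.mono_neutral_right) (auto simp: nm0)
  then have T_eq: "T m = (\<Sum>u\<in>U. of_nat (N u) * \<chi> u)" using partition[of \<chi>] by (rule trans)
  have sum_U: "(\<Sum>u\<in>U. \<chi> u) = 0"
    using sum_\<chi> finite_E[of 1] by (simp add: U_def sum_diff1)
  have card_W: "real (card W) = (\<Sum>u\<in>U. real (N u))"
  proof -
    have "of_nat (card W) = (of_nat (\<Sum>u\<in>U. N u) :: complex)" using partition[of "\<lambda>_. 1"] by simp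
    then have "card W = (\<Sum>u\<in>U. N u)" using of_nat_eq_iff by blast
    then show ?thesis by simp
  qed
  \<comment> \<open>The points lost are 0, at most \<open>Q\<close> roots of \<open>A\<close> and at
    most \<open>Q - 1\<close> roots of \<open>B\<close>.\<close>
  have "card (E m) \<le> card W + (1 + (Q + (Q - 1)))"
  proof -
    have "E m \<subseteq> W \<union> ({0} \<union> ({x. poly A x = 0} \<union> {x. poly B x = 0}))" by (auto simp: W_def)
    moreover have fin: "finite {x. poly A x = 0}" "finite {x. poly B x = 0}"
      using A_B by (auto intro!: poly_roots_finite)
    moreover have "finite W" using finE by (simp add: W_def)
    ultimately have "card (E m) \<le> card (W \<union> ({0} \<union> ({x. poly A x = 0} \<union> {x. poly B x = 0})))"
      by (intro card_mono) auto
    also have "\<dots> \<le> card W + card ({0} \<union> ({x. poly A x = 0} \<union> {x. poly B x = 0}))" by (rule card_Un_le)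
    also have "card ({0} \<union> ({x. poly A x = 0} \<union> {x. poly B x = 0})) \<le>
      card {0 :: 'b} + card ({x. poly A x = 0} \<union> {x. poly B x = 0})" by (rule card_Un_le)
    also have "card ({x. poly A x = 0} \<union> {x. poly B x = 0}) \<le> card {x. poly A x = 0} + card {x. poly B x = 0}"
      by (rule card_Un_le)
    also have "card {x. poly A x = 0} \<le> Q"
      using card_poly_roots_bound[of A] A_B(3) Q_ge_2 by fastforce
    also have "card {x. poly B x = 0} \<le> Q - 1"
      using card_poly_roots_bound[of B] A_B(1,2) by simp
    finally show ?thesis by simp
  qed
  then have "P ^ 2 \<le> card W + 2 * Q" using card_E[OF m] P2 Q_ge_2 by simp
  then have card_W_ge: "real P ^ 2 - 2 * real Q \<le> real (card W)"
    by (simp flip: of_nat_power of_nat_mult of_nat_add of_nat_le_iff add: algebra_simps)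
  have "T m = (\<Sum>u\<in>U. of_nat (N u) * \<chi> u) - of_nat D * (\<Sum>u\<in>U. \<chi> u)"
    using T_eq sum_U by simp
  also have "\<dots> = - (\<Sum>u\<in>U. of_nat (D - N u) * \<chi> u)"
    using N_le by (simp add: sum_distrib_left of_nat_diff left_diff_distrib sum_subtractf)
  finally have "cmod (T m) = cmod (\<Sum>u\<in>U. of_nat (D - N u) * \<chi> u)" by simp
  also have "\<dots> \<le> (\<Sum>u\<in>U. real D - real (N u))"
  proof (rule sum_norm_le)
    fix u assume u: "u \<in> U"
    have "cmod (of_nat (D - N u) * \<chi> u) = real (D - N u)"
      using norm_\<chi>[of u] u by (simp add: U_def norm_mult)
    then show "cmod (of_nat (D - N u) * \<chi> u) \<le> real D - real (N u)"
      using N_le[OF u] by (simp add: of_nat_diff)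
  qed
  also have "\<dots> = real (Q - 1) * real D - real (card W)"
    unfolding card_W sum_subtractf by (simp add: cardU)
  also have "\<dots> \<le> (real Q - 1) * real D - (real P ^ 2 - 2 * real Q)"
    using card_W_ge Q_ge_2 by (simp add: of_nat_diff)
  also have "real D = (real M + 2 * real Q + 1) * P"
    using Q_ge_2 unfolding D_def by (simp add: of_nat_diff)
  also have "(real Q - 1) * ((real M + 2 * real Q + 1) * P) =
      ((real Q - 1) * M) * P + (real Q - 1) * (2 * real Q + 1) * P"
    by (simp add: algebra_simps)
  also have "(real Q - 1) * M = real P - 1"
    using Q_ge_2 unfolding PM by (simp add: of_nat_diff)
  also have "(real P - 1) * P + (real Q - 1) * (2 * real Q + 1) * P - (real P ^ 2 - 2 * real Q) =
      (real Q - 1) * (2 * real Q + 1) * P + 2 * real Q - P"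
    by (simp add: power2_eq_square algebra_simps)
  also have "\<dots> \<le> (real Q - 1) * (2 * real Q + 1) * P + 2 * real Q * P"
  proof -
    have "2 * real Q * 1 \<le> 2 * real Q * P" using PM by (intro mult_left_mono) simp_all
    moreover have "0 \<le> real P" by simp
    ultimately show ?thesis by linarith
  qed
  also have "\<dots> = ((real Q - 1) * (2 * real Q + 1) + 2 * real Q) * real P"
    by (simp only: distrib_right)
  finally show ?thesis by (simp add: m_P_M_def)
qed

text \<open>
  The sums attached to all the additive characters \<open>\<lambda>x. \<psi> (t * x)\<close> are estimated together, because
  their total counts points on an Artin-Schreier cover. Every \<open>L\<close>-series has degree at most two,
  and the estimates over all even extensions determine the size of its inverse roots.
\<close>

theorem weil_bound: "cmod (\<Sum>x\<in>F. \<chi> ((x + \<delta>) / x) * \<psi> x) \<le> 2 * sqrt (real Q)"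
proof -
  define S' where "S' t m = (\<Sum>x\<in>E m. \<chi> (nm m ((x + \<delta>) / x)) * \<psi> (t * tr m x))" for t m
  have "\<forall>t\<in>F. \<exists>w. \<forall>m\<ge>1. S' t m = - (fst w ^ m + snd w ^ m)"
  proof
    fix t assume t: "t \<in> F"
    interpret scaled: character_pair Q field_type \<chi> "\<lambda>x. \<psi> (t * x)" \<delta>
      by (rule character_pair_scaled[OF t])
    obtain w1 w2 where "\<forall>m\<ge>1. scaled.S m = - (w1 ^ m + w2 ^ m)"
      using scaled.S_power_sum by blast
    moreover have "scaled.S m = S' t m" for m by (simp only: scaled.S_def S'_def)
    ultimately show "\<exists>w. \<forall>m\<ge>1. S' t m = - (fst w ^ m + snd w ^ m)"
      by (intro exI[of _ "(w1, w2)"]) simp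
  qed
  from bchoice[OF this] obtain w where
    w': "\<forall>t\<in>F. \<forall>m\<ge>1. S' t m = - (fst (w t) ^ m + snd (w t) ^ m)" ..
  define w1 w2 where "w1 t = fst (w t)" "w2 t = snd (w t)" for t
  have w: "S' t m = - (w1 t ^ m + w2 t ^ m)" if "t \<in> F" "1 \<le> m" for t m
    using w' that by (simp add: w1_w2_def)
  \<comment> \<open>Only even degrees are controlled, so the power sums are formed with the squares
    of the inverse roots. The boolean selects one of the two roots belonging to
    \<open>t\<close>.\<close>
  define v where "v = (\<lambda>(t, b). (if b then w1 t else w2 t)\<^sup>2)"
  define I where "I = F \<times> (UNIV :: bool set)"
  have sum_v: "(\<Sum>i\<in>I. v i ^ e) = - T (2 * e)" if "1 \<le> e" for e
  proof -
    have "(\<Sum>i\<in>I. v i ^ e) = (\<Sum>t\<in>F. \<Sum>b\<in>UNIV. v (t, b) ^ e)"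
      unfolding I_def by (simp add: sum.cartesian_product)
    also have "\<dots> = (\<Sum>t\<in>F. w1 t ^ (2 * e) + w2 t ^ (2 * e))"
      by (simp add: UNIV_bool v_def power_mult add.commute)
    also have "\<dots> = - T (2 * e)"
      unfolding T_def S'_def[symmetric] sum_negf[symmetric] using w that by (intro sum.cong) auto
    finally show ?thesis .
  qed
  define C where "C = (real Q - 1) * (2 * real Q + 1) + 2 * real Q"
  have "finite I" using finite_E[of 1] by (simp add: I_def)
  moreover have "cmod (\<Sum>i\<in>I. v i ^ e) \<le> C * real Q ^ e" if "3 \<le> e" for e
    using norm_T_le[OF that] sum_v[of e] that by (simp add: C_def)
  ultimately have v: "cmod (v i) \<le> real Q" if "i \<in> I" for i
    using norm_le_of_power_sums[of I 3 v C "real Q" i] that by simp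
  \<comment> \<open>The argument 1 is the field element \<open>t = 1\<close>, which belongs to
    \<psi> itself.\<close>
  have "cmod (w1 1) \<le> sqrt (real Q)" "cmod (w2 1) \<le> sqrt (real Q)"
    using v[of "(1, True)"] v[of "(1, False)"]
    by (auto simp: v_def I_def norm_power real_le_rsqrt)
  moreover have "(\<Sum>x\<in>F. \<chi> ((x + \<delta>) / x) * \<psi> x) = - (w1 1 + w2 1)"
    using w[of 1 1] by (simp add: nm_def tr_def S'_def)
  ultimately show ?thesis
    using norm_triangle_ineq[of "w1 1" "w2 1"] by (simp only: norm_minus_cancel)
qed

end

section \<open>Characters of finite fields\<close>

definition additive_character :: "('a::ab_group_add \<Rightarrow> complex) \<Rightarrow> bool" where
  "additive_character \<psi> \<longleftrightarrow> \<psi> 0 = 1 \<and> (\<forall>x y. \<psi> (x + y) = \<psi> x * \<psi> y)"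

lemma CHAR_card_primepow:
  assumes "primepow q" and "card (UNIV :: 'a::{field,finite} set) = q ^ r" and "0 < r"
  shows "prime CHAR('a)" and "\<exists>k>0. q = CHAR('a) ^ k"
proof -
  have "CHAR('a) > 0" by (intro finite_imp_CHAR_pos) simp
  then show p: "prime CHAR('a)" using prime_CHAR_semidom by blast
  obtain p' k where k: "prime p'" "k > 0" "q = p' ^ k" using assms(1) by (auto simp: primepow_def)
  \<comment> \<open>Translation by 1 permutes the field, so its cardinality is zero in it.\<close>
  have "(\<Sum>x\<in>UNIV. x :: 'a) = (\<Sum>x\<in>UNIV. x + 1)"
    by (rule sum.reindex_bij_witness[of _ "\<lambda>x. x + 1" "\<lambda>x. x - 1"]) auto
  then have "of_nat (card (UNIV :: 'a set)) = (0 :: 'a)" by (simp add: sum.distrib)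
  then have "CHAR('a) dvd p' ^ (k * r)"
    using assms(2) by (simp only: of_nat_eq_0_iff_char_dvd k power_mult)
  then have "CHAR('a) dvd p'" using p prime_dvd_power by blast
  then have "CHAR('a) = p'" using p k(1) primes_dvd_imp_eq by blast
  then show "\<exists>k>0. q = CHAR('a) ^ k" using k by blast
qed

lemma power_card_field:
  fixes x :: "'a::{field,finite}"
  shows "x ^ card (UNIV :: 'a set) = x"
proof (cases "x = 0")
  case False
  have "(\<Prod>y\<in>UNIV - {0}. y) = (\<Prod>y\<in>UNIV - {0}. x * y)"
    by (rule prod.reindex_bij_witness[of _ "\<lambda>y. x * y" "\<lambda>y. y / x"]) (use False in auto)
  also have "\<dots> = x ^ (card (UNIV :: 'a set) - 1) * (\<Prod>y\<in>UNIV - {0}. y)"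
    by (simp add: prod.distrib)
  finally have "x ^ (card (UNIV :: 'a set) - 1) = 1" by simp
  moreover have "card (UNIV :: 'a set) > 0" by (simp add: card_gt_0_iff)
  then have "x ^ card (UNIV :: 'a set) = x * x ^ (card (UNIV :: 'a set) - 1)" by (simp flip: power_Suc)
  ultimately show ?thesis by simp
qed (simp add: power_0_left)

lemma norm_mult_character:
  fixes x :: "'a::{field,finite}"
  assumes "mult_character \<chi>" "x \<noteq> 0"
  shows "cmod (\<chi> x) = 1"
proof -
  have mult: "\<chi> (a * b) = \<chi> a * \<chi> b" if "a \<noteq> 0" "b \<noteq> 0" for a b
    using assms(1) that by (simp add: mult_character_def)
  have nz: "\<chi> x \<noteq> 0" using assms by (simp add: mult_character_def)
  have "\<chi> (x ^ Suc n) = \<chi> x ^ Suc n" for n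
    using assms(2) by (induction n) (simp_all add: mult)
  moreover obtain n where n: "card (UNIV :: 'a set) = Suc (Suc n)"
    using card_UNIV_unit card_mono[of "UNIV :: 'a set" "{0, 1}"] by (auto dest!: le_Suc_ex simp: eval_nat_numeral)
  ultimately have "\<chi> x = \<chi> x * \<chi> x ^ Suc n" using power_card_field[of x] by (metis power_Suc)
  then have "\<chi> x ^ Suc n = 1" using nz by simp
  then show ?thesis using power_eq_1_iff by blast
qed

lemma norm_additive_character:
  fixes x :: "'a::{field,finite}"
  assumes "additive_character \<psi>"
  shows "cmod (\<psi> x) = 1"
proof -
  have "\<psi> (of_nat n * x) = \<psi> x ^ n" for n
    using assms by (induction n) (simp_all add: additive_character_def distrib_right)
  from this[of "CHAR('a)"] have "\<psi> x ^ CHAR('a) = 1"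
    using assms by (simp add: additive_character_def)
  moreover have "CHAR('a) > 0" by (intro finite_imp_CHAR_pos) simp
  ultimately show ?thesis using power_eq_1_iff[of "\<psi> x" "CHAR('a)"] by simp
qed

text \<open>By \<open>power_card_field\<close> the image lies in \<open>E m\<close>, and both sets
  have \<open>Q ^ m\<close> elements. This is the bridge between a finite field as a type and as a
  subset of its closure.\<close>

lemma range_to_ac:
  assumes "card (UNIV :: 'a::{field,finite} set) = Q ^ m" "0 < m" and "frobenius TYPE('a alg_closure) Q"
  shows "range (to_ac :: 'a \<Rightarrow> 'a alg_closure) = frobenius.E Q m"
proof -
  interpret frobenius Q "TYPE('a alg_closure)" by (fact assms(3))
  show ?thesis
  proof (rule card_subset_eq)
    show "finite (E m :: 'a alg_closure set)" using finite_E[OF assms(2)] .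
    show "range to_ac \<subseteq> (E m :: 'a alg_closure set)"
      using power_card_field[where 'a = 'a] by (auto simp: E_def assms(1) simp flip: to_ac_power)
    show "card (range (to_ac :: 'a \<Rightarrow> 'a alg_closure)) = card (E m :: 'a alg_closure set)"
      using card_E[OF assms(2)] card_image[OF inj_to_ac] by (metis assms(1))
  qed
qed

text \<open>Here \<open>Q\<close> is the size of the whole field, so \<open>F\<close> is the image
  of the type. The trivial \<psi> falls outside \<open>weil_sum\<close>, but then
  \<open>(x + \<delta>) / x = 1 + \<delta> / x\<close> runs through everything except 1 and the sum
  is \<open>- \<chi> 1\<close>.\<close>

lemma weil_bound_finite_field:
  fixes \<chi> \<psi> :: "'a::{field,finite} \<Rightarrow> complex"
  assumes char: "prime CHAR('a)" "\<exists>k>0. card (UNIV :: 'a set) = CHAR('a) ^ k"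
    and \<chi>: "mult_character \<chi>" "nontrivial_character \<chi>"
    and \<psi>: "additive_character \<psi>" and \<delta>: "\<delta> \<noteq> 0"
  shows "cmod (\<Sum>x\<in>UNIV. \<chi> ((x + \<delta>) / x) * \<psi> x) \<le> 2 * sqrt (card (UNIV :: 'a set))"
proof (cases "\<exists>x. \<psi> x \<noteq> 1")
  case True
  define Q where "Q = card (UNIV :: 'a set)"
  have frob: "frobenius TYPE('a alg_closure) Q"
    using char by (intro frobenius.intro) (auto simp: Q_def)
  interpret frobenius Q "TYPE('a alg_closure)" by (fact frob)
  have F: "F = range (to_ac :: 'a \<Rightarrow> 'a alg_closure)"
    using range_to_ac[OF _ _ frob, of 1] by (simp add: Q_def)
  interpret weil_sum Q "TYPE('a alg_closure)" "\<lambda>x. \<chi> (of_ac x)" "\<lambda>x. \<psi> (of_ac x)" "to_ac \<delta>"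
  proof unfold_locales
    have of_ac_hom: "of_ac (to_ac x * to_ac y) = x * y" "of_ac (to_ac x + to_ac y) = x + y" for x y :: 'a
      by (simp_all flip: to_ac_mult to_ac_add)
    show "\<chi> (of_ac (0 :: 'a alg_closure)) = 0" "\<psi> (of_ac (0 :: 'a alg_closure)) = 1"
      using \<chi> \<psi> by (simp_all add: mult_character_def additive_character_def)
    show "\<chi> (of_ac (x * y)) = \<chi> (of_ac x) * \<chi> (of_ac y)" if "x \<in> F" "y \<in> F" for x y :: "'a alg_closure"
      using that \<chi>(1) unfolding F mult_character_def
      by (auto simp: of_ac_hom) (metis mult_zero_left mult_zero_right)
    show "\<psi> (of_ac (x + y)) = \<psi> (of_ac x) * \<psi> (of_ac y)" if "x \<in> F" "y \<in> F" for x y :: "'a alg_closure"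
      using that \<psi> unfolding F additive_character_def by (auto simp: of_ac_hom)
    show "\<chi> (of_ac x) \<noteq> 0" if "x \<in> F" "x \<noteq> 0" for x :: "'a alg_closure"
      using that \<chi>(1) unfolding F mult_character_def by auto
    show "\<exists>x\<in>F. x \<noteq> (0 :: 'a alg_closure) \<and> \<chi> (of_ac x) \<noteq> 1"
      using \<chi>(2) unfolding F nontrivial_character_def by auto
    show "\<exists>x\<in>F. \<psi> (of_ac (x :: 'a alg_closure)) \<noteq> 1" using True unfolding F by auto
    show "to_ac \<delta> \<in> F" "to_ac \<delta> \<noteq> 0" using \<delta> by (simp_all add: F del: One_nat_def)
  qed
  have "of_ac ((to_ac x + to_ac \<delta>) / to_ac x) = (x + \<delta>) / x" for x
    by (metis of_ac_to_ac to_ac_add to_ac_divide)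
  then have "(\<Sum>x\<in>F. \<chi> (of_ac ((x + to_ac \<delta>) / x)) * \<psi> (of_ac x)) = (\<Sum>x\<in>UNIV. \<chi> ((x + \<delta>) / x) * \<psi> x)"
    unfolding F sum.reindex[OF inj_to_ac] by simp
  then show ?thesis using weil_bound unfolding Q_def by (simp only:)
next
  case False
  have \<chi>0: "\<chi> 0 = 0" and \<chi>1: "cmod (\<chi> 1) = 1"
    using \<chi>(1) norm_mult_character[OF \<chi>(1), of 1] by (simp_all add: mult_character_def)
  have "(\<Sum>x\<in>UNIV. \<chi> x) = 0"
  proof -
    obtain a where a: "a \<noteq> 0" "\<chi> a \<noteq> 1" using \<chi>(2) by (auto simp: nontrivial_character_def)
    have "(\<Sum>x\<in>UNIV. \<chi> x) = (\<Sum>x\<in>UNIV. \<chi> (a * x))"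
      by (rule sum.reindex_bij_witness[of _ "\<lambda>x. a * x" "\<lambda>x. x / a"]) (use a in auto)
    also have "\<dots> = (\<Sum>x\<in>UNIV. \<chi> a * \<chi> x)"
    proof (rule sum.cong[OF refl])
      fix x show "\<chi> (a * x) = \<chi> a * \<chi> x"
        using a \<chi>(1) by (cases "x = 0") (auto simp: mult_character_def)
    qed
    finally show ?thesis using a by (simp flip: sum_distrib_left)
  qed
  then have "(\<Sum>y\<in>UNIV - {1}. \<chi> y) = - \<chi> 1" by (simp add: sum_diff1)
  moreover have "(\<Sum>x\<in>UNIV - {0}. \<chi> ((x + \<delta>) / x)) = (\<Sum>y\<in>UNIV - {1}. \<chi> y)"
    by (rule sum.reindex_bij_witness[of _ "\<lambda>y. \<delta> / (y - 1)" "\<lambda>x. (x + \<delta>) / x"])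
      (use \<delta> in \<open>auto simp: field_simps\<close>)
  moreover have "(\<Sum>x\<in>UNIV. \<chi> ((x + \<delta>) / x) * \<psi> x) = (\<Sum>x\<in>UNIV - {0}. \<chi> ((x + \<delta>) / x))"
    using False \<chi>0 by (simp add: sum.remove[of UNIV 0])
  ultimately have "cmod (\<Sum>x\<in>UNIV. \<chi> ((x + \<delta>) / x) * \<psi> x) = 1" using \<chi>1 by simp
  also have "1 \<le> 2 * sqrt (real (card (UNIV :: 'a set)))"
  proof -
    have "1 \<le> card (UNIV :: 'a set)" by (simp add: Suc_le_eq card_gt_0_iff)
    then have "1 \<le> sqrt (real (card (UNIV :: 'a set)))" by simp
    then show ?thesis by linarith
  qed
  finally show ?thesis .
qed

text \<open>A \<open>p\<close>-th root of unity is raised to the absolute trace. The trace is a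
  polynomial of degree at most \<open>p ^ (n - 1)\<close>, so it cannot vanish on all
  \<open>p ^ n\<close> elements.\<close>

lemma exists_nontrivial_additive_character:
  assumes char: "prime CHAR('k)" "card (UNIV :: 'k set) = CHAR('k) ^ n" "0 < n"
  shows "\<exists>\<psi> :: 'k::{field,finite} \<Rightarrow> complex. additive_character \<psi> \<and> (\<exists>x. \<psi> x \<noteq> 1)"
proof -
  define p where "p = CHAR('k)"
  have p: "2 \<le> p" using char(1) prime_ge_2_nat by (simp add: p_def)
  have frob: "frobenius TYPE('k alg_closure) p"
    using char(1) by (intro frobenius.intro) (auto simp: p_def intro: exI[of _ 1])
  interpret frobenius p "TYPE('k alg_closure)" by (fact frob)
  have E: "E n = range (to_ac :: 'k \<Rightarrow> 'k alg_closure)"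
    using range_to_ac[OF _ char(3) frob] char(2) by (simp add: p_def)
  have F: "F = of_nat ` {..<p}"
  proof (rule card_subset_eq[symmetric])
    show "finite (F :: 'k alg_closure set)" using finite_E[of 1] by simp
    show "of_nat ` {..<p} \<subseteq> (F :: 'k alg_closure set)"
    proof clarify
      fix j show "of_nat j \<in> (F :: 'k alg_closure set)"
        by (induction j) (auto intro: E_closed simp del: One_nat_def)
    qed
    have "inj_on (of_nat :: nat \<Rightarrow> 'k alg_closure) {..<p}"
      by (auto intro!: inj_onI simp: of_nat_eq_iff_cong_CHAR cong_def p_def)
    then show "card (of_nat ` {..<p} :: 'k alg_closure set) = card (F :: 'k alg_closure set)"
      using card_E[of 1] by (simp add: card_image)
  qed
  \<comment> \<open>The trace lies in the prime field and is \<open>of_nat\<close> of some number.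
    That number is determined only modulo \<open>p\<close>, which suffices by
    \<open>\<zeta>_cong\<close>.\<close>
  define j :: "'k \<Rightarrow> nat" where "j x = (SOME i. of_nat i = tr n (to_ac x))" for x
  have j: "of_nat (j x) = tr n (to_ac x)" for x
  proof -
    have "tr n (to_ac x) \<in> F" using E by (intro tr_in_F) auto
    then have "\<exists>i. of_nat i = tr n (to_ac x)" unfolding F by auto
    then show ?thesis unfolding j_def by (rule someI_ex)
  qed
  define \<zeta> where "\<zeta> = cis (2 * pi / p)"
  have \<zeta>p: "\<zeta> ^ p = 1" using p by (simp add: \<zeta>_def DeMoivre)
  have \<zeta>1: "\<zeta> \<noteq> 1"
  proof
    assume "\<zeta> = 1"
    moreover have "inj_on (\<lambda>k. cis (2 * pi * real k / real p)) {..<p}"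
      using bij_betw_roots_unity[of p] p by (simp add: bij_betw_def)
    ultimately show False
      using p inj_onD[of "\<lambda>k. cis (2 * pi * real k / real p)" "{..<p}" 1 0] by (simp add: \<zeta>_def)
  qed
  have \<zeta>_cong: "\<zeta> ^ a = \<zeta> ^ b" if "(of_nat a :: 'k alg_closure) = of_nat b" for a b
  proof -
    have "\<zeta> ^ a = \<zeta> ^ (a mod p)" for a
    proof -
      have "\<zeta> ^ a = (\<zeta> ^ p) ^ (a div p) * \<zeta> ^ (a mod p)" by (simp flip: power_mult power_add)
      then show ?thesis by (simp add: \<zeta>p)
    qed
    moreover have "a mod p = b mod p" using that by (simp add: of_nat_eq_iff_cong_CHAR cong_def p_def)
    ultimately show ?thesis by metis
  qed
  define \<psi> where "\<psi> x = \<zeta> ^ j x" for x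
  have "\<psi> (x + y) = \<psi> x * \<psi> y" for x y
    unfolding \<psi>_def power_add[symmetric] by (rule \<zeta>_cong) (simp add: j tr_add)
  moreover have "tr n 0 = 0" by (simp add: tr_def power_0_left)
  then have "\<psi> 0 = 1"
    using \<zeta>_cong[of "j 0" 0] by (simp add: \<psi>_def j)
  moreover have "\<exists>x. \<psi> x \<noteq> 1"
  proof -
    have "\<exists>y\<in>E n. tr n y \<noteq> (0 :: 'k alg_closure)"
    proof (rule ccontr)
      assume "\<not> ?thesis"
      then have zero: "tr n y = 0" if "y \<in> E n" for y :: "'k alg_closure" using that by blast
      define f :: "'k alg_closure poly" where "f = (\<Sum>i<n. monom 1 (p ^ i))"
      have "coeff f (p ^ 0) = (\<Sum>i<n. if i = 0 then 1 else 0)"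
        unfolding f_def coeff_sum coeff_monom using p by (intro sum.cong) auto
      then have f0: "f \<noteq> 0" using char(3) by auto
      have "p ^ n = card (E n :: 'k alg_closure set)" using card_E[OF char(3)] by simp
      also have "\<dots> \<le> degree f"
        using zero by (intro card_poly_roots_le(2)[OF f0]) (simp add: f_def poly_sum poly_monom tr_def)
      also have "\<dots> \<le> p ^ (n - 1)"
        unfolding f_def using p char(3)
        by (intro degree_sum_le) (auto simp: degree_monom_eq intro!: power_increasing)
      also have "\<dots> < p ^ n" using p char(3) by (intro power_strict_increasing) auto
      finally show False by simp
    qed
    then obtain y :: "'k alg_closure" where y: "y \<in> E n" "tr n y \<noteq> 0" by blast
    have "tr n y \<in> F" using y by (intro tr_in_F)
    \<comment> \<open>Dividing \<open>y\<close> by its trace gives an element of trace 1, at which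
      \<psi> takes the value \<zeta>.\<close>
    then have "1 / tr n y \<in> F" by (intro E_closed) auto
    moreover from this have "y / tr n y \<in> E n" using y F_subset_E E_closed(3)[of "1 / tr n y" n y] by auto
    moreover have "tr n (1 / tr n y * y) = 1 / tr n y * tr n y" by (rule tr_mult_F) fact
    ultimately obtain x where "tr n (to_ac x) = (1 :: 'k alg_closure)" using y unfolding E by auto
    then have "\<psi> x = \<zeta>" using \<zeta>_cong[of "j x" 1] by (simp add: \<psi>_def j)
    then show ?thesis using \<zeta>1 by blast
  qed
  ultimately show ?thesis
    unfolding additive_character_def by (intro exI[of _ \<psi>] conjI allI)
qed

section \<open>Missing digits\<close>

lemma sum_additive_character_scaled:
  fixes \<psi> :: "'k::{field,finite} \<Rightarrow> complex"
  assumes \<psi>: "additive_character \<psi>" "\<exists>x. \<psi> x \<noteq> 1"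
  shows "(\<Sum>t\<in>UNIV. \<psi> (t * a)) = (if a = 0 then of_nat (card (UNIV :: 'k set)) else 0)"
proof (cases "a = 0")
  case True
  then show ?thesis using \<psi> by (simp add: additive_character_def)
next
  case False
  obtain b where b: "\<psi> b \<noteq> 1" using \<psi> by blast
  have "(\<Sum>t\<in>UNIV. \<psi> (t * a)) = (\<Sum>t\<in>UNIV. \<psi> ((t + b / a) * a))"
    by (rule sum.reindex_bij_witness[of _ "\<lambda>t. t + b / a" "\<lambda>t. t - b / a"]) auto
  also have "\<dots> = (\<Sum>t\<in>UNIV. \<psi> (t * a)) * \<psi> b"
    using \<psi> False by (simp add: distrib_right additive_character_def sum_distrib_right)
  finally show ?thesis using b False by simp
qed

text \<open>The indicator of \<open>f i x = 0\<close> is the average of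
  \<open>\<psi>\<^sub>0 (t * f i x)\<close> over \<open>t\<close>, and each of these factors is
  absorbed into \<psi>. An average of bounded sums obeys the same bound, so imposing linear
  conditions costs nothing. The induction has to treat all \<psi> at once.\<close>

lemma completed_sum_le:
  fixes G :: "'a::{ab_group_add,finite} \<Rightarrow> complex" and f :: "'i \<Rightarrow> 'a \<Rightarrow> 'k::{field,finite}"
  assumes I: "finite I" and f: "\<And>i x y. f i (x + y) = f i x + f i y"
    and \<psi>\<^sub>0: "additive_character \<psi>\<^sub>0" "\<exists>x :: 'k. \<psi>\<^sub>0 x \<noteq> 1"
    and bound: "\<And>\<psi>. additive_character \<psi> \<Longrightarrow> cmod (\<Sum>x\<in>UNIV. G x * \<psi> x) \<le> C"
    and \<psi>: "additive_character \<psi>"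
  shows "cmod (\<Sum>x | \<forall>i\<in>I. f i x = 0. G x * \<psi> x) \<le> C"
  using I \<psi>
proof (induction I arbitrary: \<psi> rule: finite_induct)
  case empty
  then show ?case using bound by simp
next
  case (insert i I)
  define V where "V = {x. \<forall>i\<in>I. f i x = 0}"
  define n where "n = card (UNIV :: 'k set)"
  have n: "n > 0" by (simp add: n_def card_gt_0_iff)
  have f0: "f i 0 = 0" using f[of i 0 0] by (metis add_cancel_right_right add_0)
  have twist: "additive_character (\<lambda>x. \<psi> x * \<psi>\<^sub>0 (t * f i x))" for t
    using insert.prems \<psi>\<^sub>0(1) by (simp add: additive_character_def f f0 distrib_left)
  have "of_nat n * (\<Sum>x | \<forall>i\<in>insert i I. f i x = 0. G x * \<psi> x) =
      (\<Sum>x | \<forall>i\<in>insert i I. f i x = 0. of_nat n * (G x * \<psi> x))"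
    by (simp add: sum_distrib_left)
  also have "\<dots> = (\<Sum>x\<in>V. if f i x = 0 then of_nat n * (G x * \<psi> x) else 0)"
    by (subst sum.inter_filter[symmetric]) (auto simp: V_def intro!: sum.cong)
  also have "\<dots> = (\<Sum>x\<in>V. \<Sum>t\<in>UNIV. G x * (\<psi> x * \<psi>\<^sub>0 (t * f i x)))"
  proof (rule sum.cong[OF refl])
    fix x
    have "(\<Sum>t\<in>UNIV. G x * (\<psi> x * \<psi>\<^sub>0 (t * f i x))) = G x * \<psi> x * (\<Sum>t\<in>UNIV. \<psi>\<^sub>0 (t * f i x))"
      by (simp add: sum_distrib_left mult.assoc)
    then show "(if f i x = 0 then of_nat n * (G x * \<psi> x) else 0) = (\<Sum>t\<in>UNIV. G x * (\<psi> x * \<psi>\<^sub>0 (t * f i x)))"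
      unfolding sum_additive_character_scaled[OF \<psi>\<^sub>0] by (simp add: n_def)
  qed
  also have "\<dots> = (\<Sum>t\<in>UNIV. \<Sum>x\<in>V. G x * (\<psi> x * \<psi>\<^sub>0 (t * f i x)))" by (rule sum.swap)
  finally have eq: "of_nat n * (\<Sum>x | \<forall>i\<in>insert i I. f i x = 0. G x * \<psi> x) =
      (\<Sum>t\<in>UNIV. \<Sum>x\<in>V. G x * (\<psi> x * \<psi>\<^sub>0 (t * f i x)))" .
  have "real n * cmod (\<Sum>x | \<forall>i\<in>insert i I. f i x = 0. G x * \<psi> x) =
      cmod (of_nat n * (\<Sum>x | \<forall>i\<in>insert i I. f i x = 0. G x * \<psi> x))"
    by (simp only: norm_mult norm_of_nat)
  also have "\<dots> \<le> (\<Sum>t\<in>(UNIV :: 'k set). C)"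
    unfolding eq V_def by (intro sum_norm_le insert.IH[OF twist])
  also have "\<dots> = real n * C" by (simp add: n_def)
  finally show ?case using n by simp
qed

section \<open>Coordinates, boxes and their decomposition\<close>

locale extension_basis =
  fixes \<iota> :: "'k::{field,finite} \<Rightarrow> 'a::{field,finite}" and r :: nat and \<beta> :: "nat \<Rightarrow> 'a"
  assumes embedding: "field_embedding \<iota>" and basis: "is_ext_basis \<iota> r \<beta>"
begin

text \<open>The choice leaves the values at indices outside \<open>{1..r}\<close>
  undetermined.\<close>

definition coord :: "'a \<Rightarrow> nat \<Rightarrow> 'k" where "coord x = (SOME a. x = lin_comb \<iota> r \<beta> a)"

text \<open>With factors such as \<open>- {c i}\<close>, \<open>UNIV\<close> and \<open>{0}\<close>
  this covers the digit set, the coordinate subspaces and the two pieces of a splitting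
  alike.\<close>

definition box :: "(nat \<Rightarrow> 'k set) \<Rightarrow> 'a set" where "box D = {x. \<forall>i\<in>{1..r}. coord x i \<in> D i}"

lemma lin_comb_coord [simp]: "lin_comb \<iota> r \<beta> (coord x) = x"
  unfolding coord_def using someI_ex[OF lin_comb_exists[OF embedding basis, of x]] by simp

lemma coord_lin_comb [simp]: "i \<in> {1..r} \<Longrightarrow> coord (lin_comb \<iota> r \<beta> a) i = a i"
  using lin_comb_unique[OF embedding basis] lin_comb_coord by blast

lemma lin_comb_cong: "(\<And>i. i \<in> {1..r} \<Longrightarrow> a i = b i) \<Longrightarrow> lin_comb \<iota> r \<beta> a = lin_comb \<iota> r \<beta> b"
  by (auto simp: lin_comb_def)

lemma coord_eqI: "(\<And>i. i \<in> {1..r} \<Longrightarrow> coord x i = coord y i) \<Longrightarrow> x = y"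
  using lin_comb_cong[of "coord x" "coord y"] by simp

lemma coord_add: "i \<in> {1..r} \<Longrightarrow> coord (x + y) i = coord x i + coord y i"
proof -
  assume i: "i \<in> {1..r}"
  have "x + y = lin_comb \<iota> r \<beta> (coord x) + lin_comb \<iota> r \<beta> (coord y)" by simp
  also have "\<dots> = lin_comb \<iota> r \<beta> (\<lambda>i. coord x i + coord y i)"
    using embedding
    by (simp only: lin_comb_def ext_scale_def field_embedding_def distrib_right sum.distrib)
  finally show ?thesis using i by (metis coord_lin_comb)
qed

lemma coord_diff: "i \<in> {1..r} \<Longrightarrow> coord (x - y) i = coord x i - coord y i"
  using coord_add[of i "x - y" y] by simp

lemma card_box: "card (box D) = (\<Prod>i=1..r. card (D i))"
proof -
  have "bij_betw (lin_comb \<iota> r \<beta>) (PiE {1..r} D) (box D)"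
  proof (rule bij_betw_imageI)
    show "inj_on (lin_comb \<iota> r \<beta>) (PiE {1..r} D)"
    proof (rule inj_onI)
      fix a b assume "a \<in> PiE {1..r} D" "b \<in> PiE {1..r} D" "lin_comb \<iota> r \<beta> a = lin_comb \<iota> r \<beta> b"
      then show "a = b" using lin_comb_unique[OF embedding basis] by (intro PiE_ext) blast+
    qed
    show "lin_comb \<iota> r \<beta> ` PiE {1..r} D = box D"
    proof (intro equalityI subsetI)
      fix x assume "x \<in> lin_comb \<iota> r \<beta> ` PiE {1..r} D"
      then show "x \<in> box D" by (auto simp: box_def PiE_def Pi_def simp del: atLeastAtMost_iff)
    next
      fix x assume x: "x \<in> box D"
      have "x = lin_comb \<iota> r \<beta> (restrict (coord x) {1..r})"
        using lin_comb_cong[of "coord x" "restrict (coord x) {1..r}"] by simp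
      moreover have "restrict (coord x) {1..r} \<in> PiE {1..r} D" using x by (auto simp: box_def)
      ultimately show "x \<in> lin_comb \<iota> r \<beta> ` PiE {1..r} D" by blast
    qed
  qed
  then have "card (box D) = card (PiE {1..r} D)" by (metis bij_betw_same_card)
  then show ?thesis by (simp add: card_PiE)
qed

lemma card_box_split:
  assumes "m \<le> r"
  shows "card (box (\<lambda>i. if i \<le> m then D i else D' i)) = (\<Prod>i=1..m. card (D i)) * (\<Prod>i=m+1..r. card (D' i))"
proof -
  have "{1..r} = {1..m} \<union> {m+1..r}" using assms by auto
  then have "(\<Prod>i=1..r. card (if i \<le> m then D i else D' i)) =
      (\<Prod>i=1..m. card (if i \<le> m then D i else D' i)) * (\<Prod>i=m+1..r. card (if i \<le> m then D i else D' i))"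
    by (simp add: prod.union_disjoint)
  then show ?thesis unfolding card_box by simp
qed

lemma sum_box_split:
  fixes g :: "'a \<Rightarrow> complex"
  shows "(\<Sum>x\<in>box D. g x) = (\<Sum>a\<in>box (\<lambda>i. if i \<le> m then D i else {0}).
    \<Sum>b\<in>box (\<lambda>i. if i \<le> m then {0} else D i). g (a + b))"
proof -
  \<comment> \<open>\<open>pr\<close> is the projection to the first \<open>m\<close> coordinates,
    so the splitting of \<open>x\<close> is \<open>pr x + (x - pr x)\<close>.\<close>
  define pr where "pr x = lin_comb \<iota> r \<beta> (\<lambda>i. if i \<le> m then coord x i else 0)" for x
  have pr: "coord (pr x) i = (if i \<le> m then coord x i else 0)" if "i \<in> {1..r}" for x i
    unfolding pr_def using that by simp
  have "(\<Sum>x\<in>box D. g x) =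
    (\<Sum>p\<in>box (\<lambda>i. if i \<le> m then D i else {0}) \<times> box (\<lambda>i. if i \<le> m then {0} else D i). g (fst p + snd p))"
  proof (rule sum.reindex_bij_witness[of _ "\<lambda>p. fst p + snd p" "\<lambda>x. (pr x, x - pr x)"])
    fix x assume x: "x \<in> box D"
    show "(pr x, x - pr x) \<in> box (\<lambda>i. if i \<le> m then D i else {0}) \<times> box (\<lambda>i. if i \<le> m then {0} else D i)"
      using x by (auto simp: box_def pr coord_diff simp del: atLeastAtMost_iff)
  next
    fix p assume p: "p \<in> box (\<lambda>i. if i \<le> m then D i else {0}) \<times> box (\<lambda>i. if i \<le> m then {0} else D i)"
    then have c: "coord (fst p) i \<in> (if i \<le> m then D i else {0})" "coord (snd p) i \<in> (if i \<le> m then {0} else D i)"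
      if "i \<in> {1..r}" for i using that by (auto simp: box_def simp del: atLeastAtMost_iff)
    have "pr (fst p + snd p) = fst p"
    proof (rule coord_eqI)
      fix i assume i: "i \<in> {1..r}"
      show "coord (pr (fst p + snd p)) i = coord (fst p) i"
        using c[OF i] by (auto simp: pr[OF i] coord_add[OF i] split: if_splits)
    qed
    then show "(pr (fst p + snd p), fst p + snd p - pr (fst p + snd p)) = p" by simp
    show "fst p + snd p \<in> box D"
      unfolding box_def
    proof (intro CollectI ballI)
      fix i assume i: "i \<in> {1..r}"
      show "coord (fst p + snd p) i \<in> D i" using c[OF i] by (auto simp: coord_add[OF i] split: if_splits)
    qed
  qed simp_all
  then show ?thesis by (simp add: sum.cartesian_product split_def)
qed

lemma missing_digits_box: "missing_digits \<iota> r \<beta> c = box (\<lambda>i. - {c i})"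
proof -
  have "missing_digits \<iota> r \<beta> c = {lin_comb \<iota> r \<beta> a | a. \<forall>i\<in>{1..r}. a i \<noteq> c i}"
    by (rule missing_digits_eq[OF embedding basis])
  also have "\<dots> = box (\<lambda>i. - {c i})"
  proof (intro equalityI subsetI)
    fix x assume "x \<in> {lin_comb \<iota> r \<beta> a | a. \<forall>i\<in>{1..r}. a i \<noteq> c i}"
    then show "x \<in> box (\<lambda>i. - {c i})" by (auto simp: box_def simp del: atLeastAtMost_iff)
  next
    fix x assume "x \<in> box (\<lambda>i. - {c i})"
    then show "x \<in> {lin_comb \<iota> r \<beta> a | a. \<forall>i\<in>{1..r}. a i \<noteq> c i}"
      by (intro CollectI exI[of _ "coord x"]) (simp add: box_def)
  qed
  finally show ?thesis .
qed

end

text \<open>Nonnegativity of the variance, scaled by \<open>n\<close> to avoid fractions.\<close>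

lemma sum_squared_le_card:
  fixes f :: "'i \<Rightarrow> real"
  assumes "finite I"
  shows "(\<Sum>i\<in>I. f i)\<^sup>2 \<le> card I * (\<Sum>i\<in>I. (f i)\<^sup>2)"
proof (cases "I = {}")
  case False
  define n s where "n = real (card I)" "s = (\<Sum>i\<in>I. f i)"
  have n: "n > 0" using assms False by (simp add: n_s_def card_gt_0_iff)
  have "0 \<le> (\<Sum>i\<in>I. (n * f i - s)\<^sup>2)" by (intro sum_nonneg) simp
  also have "\<dots> = (\<Sum>i\<in>I. n * n * (f i)\<^sup>2 - 2 * n * s * f i + s\<^sup>2)"
    by (intro sum.cong refl) (simp add: power2_eq_square algebra_simps)
  also have "\<dots> = n * n * (\<Sum>i\<in>I. (f i)\<^sup>2) - 2 * n * s * s + n * s\<^sup>2"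
    by (simp add: sum.distrib sum_subtractf sum_distrib_left[symmetric] n_s_def)
  also have "\<dots> = n * (n * (\<Sum>i\<in>I. (f i)\<^sup>2) - s\<^sup>2)" by (simp add: power2_eq_square algebra_simps)
  finally have "0 \<le> n * (\<Sum>i\<in>I. (f i)\<^sup>2) - s\<^sup>2" using n by (simp add: zero_le_mult_iff)
  then show ?thesis by (simp add: n_s_def)
qed simp

text \<open>Off zero \<chi> has modulus 1, so conjugation inverts it and the product becomes
  \<open>\<chi> ((x + b) / (x + b'))\<close>, zeros included. A shift by \<open>b'\<close> turns
  this into Weil's sum with \<open>\<delta> = b - b'\<close>, up to the factor
  \<open>\<psi> (- b')\<close> of modulus 1.\<close>

lemma correlation_bound:
  fixes \<chi> \<psi> :: "'a::{field,finite} \<Rightarrow> complex"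
  assumes char: "prime CHAR('a)" "\<exists>k>0. card (UNIV :: 'a set) = CHAR('a) ^ k"
    and \<chi>: "mult_character \<chi>" "nontrivial_character \<chi>"
    and \<psi>: "additive_character \<psi>" and b: "b \<noteq> b'"
  shows "cmod (\<Sum>x\<in>UNIV. \<chi> (x + b) * cnj (\<chi> (x + b')) * \<psi> x) \<le> 2 * sqrt (card (UNIV :: 'a set))"
proof -
  have quot: "\<chi> y * cnj (\<chi> z) = \<chi> (y / z)" for y z
  proof (cases "y = 0 \<or> z = 0")
    case True then show ?thesis using \<chi>(1) by (auto simp: mult_character_def)
  next
    case False
    have mult: "\<chi> (y / z * z) = \<chi> (y / z) * \<chi> z"
      using \<chi>(1) False unfolding mult_character_def by (metis divide_eq_0_iff)
    have "\<chi> y = \<chi> (y / z * z)" using False by simp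
    also note mult
    finally have "\<chi> y * cnj (\<chi> z) = \<chi> (y / z) * (\<chi> z * cnj (\<chi> z))" by simp
    also have "\<chi> z * cnj (\<chi> z) = 1"
      using norm_mult_character[OF \<chi>(1), of z] False by (simp add: complex_norm_square[symmetric])
    finally show ?thesis by simp
  qed
  have "(\<Sum>x\<in>UNIV. \<chi> (x + b) * cnj (\<chi> (x + b')) * \<psi> x) = (\<Sum>x\<in>UNIV. \<chi> ((x + b) / (x + b')) * \<psi> x)"
    by (simp add: quot)
  also have "\<dots> = (\<Sum>x\<in>UNIV. \<chi> ((x + (b - b')) / x) * \<psi> (x - b'))"
    by (rule sum.reindex_bij_witness[of _ "\<lambda>x. x - b'" "\<lambda>x. x + b'"]) (auto simp: algebra_simps)
  also have "\<dots> = (\<Sum>x\<in>UNIV. \<chi> ((x + (b - b')) / x) * \<psi> x) * \<psi> (- b')"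
  proof -
    have "\<psi> (x - b') = \<psi> x * \<psi> (- b')" for x
      using \<psi> unfolding additive_character_def by (metis diff_conv_add_uminus)
    then show ?thesis by (simp add: sum_distrib_right mult.assoc)
  qed
  finally have "cmod (\<Sum>x\<in>UNIV. \<chi> (x + b) * cnj (\<chi> (x + b')) * \<psi> x) =
      cmod (\<Sum>x\<in>UNIV. \<chi> ((x + (b - b')) / x) * \<psi> x)"
    using norm_additive_character[OF \<psi>, of "- b'"] by (simp add: norm_mult)
  also have "\<dots> \<le> 2 * sqrt (card (UNIV :: 'a set))"
    using b by (intro weil_bound_finite_field[OF char \<chi> \<psi>]) simp
  finally show ?thesis .
qed

lemma sum_norm_square_le:
  fixes \<chi> :: "'a::{field,finite} \<Rightarrow> complex" and C :: real
  assumes \<chi>: "mult_character \<chi>"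
    and off_diagonal: "\<And>b b'. b \<noteq> b' \<Longrightarrow> cmod (\<Sum>a\<in>V. \<chi> (a + b) * cnj (\<chi> (a + b'))) \<le> C"
    and C: "0 \<le> C"
  shows "(\<Sum>a\<in>V. (cmod (\<Sum>b\<in>W. \<chi> (a + b)))\<^sup>2) \<le> card W * card V + (card W)\<^sup>2 * C"
proof -
  have le1: "cmod (\<chi> x) \<le> 1" for x
    using norm_mult_character[OF \<chi>, of x] \<chi> by (cases "x = 0") (auto simp: mult_character_def)
  define R where "R b b' = (\<Sum>a\<in>V. \<chi> (a + b) * cnj (\<chi> (a + b')))" for b b'
  \<comment> \<open>Allowing \<open>C\<close> on the diagonal too lets the double sum separate into
    the two terms of the claim.\<close>
  have R_le: "cmod (R b b') \<le> (if b = b' then real (card V) else 0) + C" for b b'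
  proof (cases "b = b'")
    case True
    have "cmod (R b b') \<le> (\<Sum>a\<in>V. 1)"
      unfolding R_def
    proof (rule sum_norm_le)
      fix a show "cmod (\<chi> (a + b) * cnj (\<chi> (a + b'))) \<le> 1"
        using mult_mono[OF le1[of "a + b"] le1[of "a + b'"]] by (simp add: norm_mult)
    qed
    then show ?thesis using True C by simp
  next
    case False
    then show ?thesis using off_diagonal[of b b'] by (simp add: R_def)
  qed
  have "complex_of_real (\<Sum>a\<in>V. (cmod (\<Sum>b\<in>W. \<chi> (a + b)))\<^sup>2) =
      (\<Sum>a\<in>V. \<Sum>b\<in>W. \<Sum>b'\<in>W. \<chi> (a + b) * cnj (\<chi> (a + b')))"
    by (simp add: complex_norm_square sum_product del: of_real_power)
  also have "\<dots> = (\<Sum>b\<in>W. \<Sum>a\<in>V. \<Sum>b'\<in>W. \<chi> (a + b) * cnj (\<chi> (a + b')))"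
    by (rule sum.swap)
  also have "\<dots> = (\<Sum>b\<in>W. \<Sum>b'\<in>W. R b b')"
    unfolding R_def by (intro sum.cong refl sum.swap)
  finally have eq: "complex_of_real (\<Sum>a\<in>V. (cmod (\<Sum>b\<in>W. \<chi> (a + b)))\<^sup>2) = (\<Sum>b\<in>W. \<Sum>b'\<in>W. R b b')" .
  have "0 \<le> (\<Sum>a\<in>V. (cmod (\<Sum>b\<in>W. \<chi> (a + b)))\<^sup>2)" by (intro sum_nonneg) simp
  then have "(\<Sum>a\<in>V. (cmod (\<Sum>b\<in>W. \<chi> (a + b)))\<^sup>2) =
      cmod (complex_of_real (\<Sum>a\<in>V. (cmod (\<Sum>b\<in>W. \<chi> (a + b)))\<^sup>2))"
    by (simp only: norm_of_real abs_of_nonneg)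
  also have "\<dots> \<le> (\<Sum>b\<in>W. \<Sum>b'\<in>W. (if b = b' then real (card V) else 0) + C)"
    unfolding eq by (intro sum_norm_le R_le)
  also have "\<dots> = card W * card V + (card W)\<^sup>2 * C"
    by (simp add: sum.distrib power2_eq_square distrib_left mult.assoc)
  finally show ?thesis .
qed

theorem theorem2p2:
  fixes q r :: nat
    and \<iota> :: "'k::{field,finite} \<Rightarrow> 'a::{field,finite}"
    and \<beta> :: "nat \<Rightarrow> 'a"
    and c :: "nat \<Rightarrow> 'k"
    and \<chi> :: "'a \<Rightarrow> complex"
  assumes "primepow q" and "r \<ge> 2"
    and "card (UNIV :: 'k set) = q" and "card (UNIV :: 'a set) = q ^ r"
    and "field_embedding \<iota>"
    and "is_ext_basis \<iota> r \<beta>"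
    and "mult_character \<chi>" and "nontrivial_character \<chi>"
  shows "cmod (\<Sum>y\<in>missing_digits \<iota> r \<beta> c. \<chi> y)
    \<le> sqrt 3 * (real q - 1) powr (real r / 2)
        * real q powr (real_of_int \<lceil>3 * real r / 4\<rceil> / 2)"
proof -
  interpret extension_basis \<iota> r \<beta> using assms(5,6) by unfold_locales
  define m where "m = nat \<lceil>3 * real r / 4\<rceil>"
  have m_ceil: "real_of_int \<lceil>3 * real r / 4\<rceil> = real m" by (simp add: m_def)
  have "3 * real r / 4 \<le> real m" unfolding m_ceil[symmetric] by (rule le_of_int_ceiling)
  then have m4: "3 * r \<le> 4 * m" by linarith
  have "\<lceil>3 * real r / 4\<rceil> \<le> int r" by (simp add: ceiling_le_iff)
  then have m_r: "m \<le> r" by (simp add: m_def)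
  have q2: "2 \<le> q" using assms(1) by (metis primepow_gt_Suc_0 Suc_leI numeral_2_eq_2)
  define D where "D i = - {c i}" for i
  define A where "A = box (\<lambda>i. if i \<le> m then D i else {0})"
  define W where "W = box (\<lambda>i. if i \<le> m then {0} else D i)"
  define V where "V = box (\<lambda>i. if i \<le> m then UNIV else {0})"
  have card_D: "card (D i) = q - 1" for i
    unfolding D_def using assms(3) by (simp add: Compl_eq_Diff_UNIV)
  have card_A: "card A = (q - 1) ^ m" unfolding A_def card_box_split[OF m_r] by (simp add: card_D)
  have card_W: "card W = (q - 1) ^ (r - m)" unfolding W_def card_box_split[OF m_r] by (simp add: card_D)
  have card_V: "card V = q ^ m" unfolding V_def card_box_split[OF m_r] by (simp add: assms(3))
  have V: "V = {x. \<forall>i\<in>{m+1..r}. coord x i = 0}" by (auto simp: V_def box_def)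
  have char_a: "prime CHAR('a)" "\<exists>k>0. card (UNIV :: 'a set) = CHAR('a) ^ k"
  proof -
    show "prime CHAR('a)" using CHAR_card_primepow(1)[OF assms(1,4)] assms(2) by simp
    obtain k where "k > 0" "q = CHAR('a) ^ k" using CHAR_card_primepow(2)[OF assms(1,4)] assms(2) by auto
    then show "\<exists>k>0. card (UNIV :: 'a set) = CHAR('a) ^ k"
      using assms(2,4) by (intro exI[of _ "k * r"]) (simp add: power_mult)
  qed
  obtain \<psi>\<^sub>0 :: "'k \<Rightarrow> complex" where \<psi>\<^sub>0: "additive_character \<psi>\<^sub>0" "\<exists>x. \<psi>\<^sub>0 x \<noteq> 1"
  proof -
    have "card (UNIV :: 'k set) = q ^ 1" using assms(3) by simp
    note k = CHAR_card_primepow[OF assms(1) this]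
    obtain n where "n > 0" "q = CHAR('k) ^ n" using k(2) by auto
    then show ?thesis using exists_nontrivial_additive_character[of n] k(1) assms(3) that by auto
  qed
  define C where "C = 2 * sqrt (card (UNIV :: 'a set))"
  have off_diagonal: "cmod (\<Sum>a\<in>V. \<chi> (a + b) * cnj (\<chi> (a + b'))) \<le> C" if "b \<noteq> b'" for b b'
  proof -
    \<comment> \<open>The default 0 makes \<open>f i\<close> additive for every \<open>i\<close>,
      which \<open>coord\<close> guarantees only inside \<open>{1..r}\<close>.\<close>
    define f where "f i x = (if i \<in> {1..r} then coord x i else 0)" for i x
    have "f i (x + y) = f i x + f i y" for i x y by (simp add: f_def coord_add del: atLeastAtMost_iff)
    moreover have "additive_character (\<lambda>x :: 'a. 1)" by (simp add: additive_character_def)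
    ultimately have "cmod (\<Sum>x | \<forall>i\<in>{m+1..r}. f i x = 0. \<chi> (x + b) * cnj (\<chi> (x + b')) * 1) \<le> C"
      unfolding C_def
      using that by (intro completed_sum_le[OF _ _ \<psi>\<^sub>0] correlation_bound[OF char_a assms(7,8)]) auto
    moreover have "{x. \<forall>i\<in>{m+1..r}. f i x = 0} = V" by (auto simp: V f_def)
    ultimately show ?thesis by simp
  qed
  have "cmod (\<Sum>y\<in>missing_digits \<iota> r \<beta> c. \<chi> y) = cmod (\<Sum>a\<in>A. \<Sum>b\<in>W. \<chi> (a + b))"
    unfolding missing_digits_box A_def W_def D_def by (subst sum_box_split[of _ _ m]) simp
  also have "\<dots> \<le> (\<Sum>a\<in>A. cmod (\<Sum>b\<in>W. \<chi> (a + b)))" by (rule norm_sum)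
  finally have "(cmod (\<Sum>y\<in>missing_digits \<iota> r \<beta> c. \<chi> y))\<^sup>2 \<le> (\<Sum>a\<in>A. cmod (\<Sum>b\<in>W. \<chi> (a + b)))\<^sup>2"
    by (intro power_mono) simp_all
  also have "\<dots> \<le> card A * (\<Sum>a\<in>A. (cmod (\<Sum>b\<in>W. \<chi> (a + b)))\<^sup>2)"
    by (intro sum_squared_le_card) simp
  \<comment> \<open>The squares are nonnegative, so the range may grow. Unlike \<open>A\<close>, the
    set \<open>V\<close> is cut out by linear conditions, which is what
    \<open>completed_sum_le\<close> can handle.\<close>
  also have "\<dots> \<le> card A * (\<Sum>a\<in>V. (cmod (\<Sum>b\<in>W. \<chi> (a + b)))\<^sup>2)"
    by (intro mult_left_mono sum_mono2) (auto simp: A_def V_def box_def split: if_splits)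
  also have "\<dots> \<le> card A * (card W * card V + (card W)\<^sup>2 * C)"
    by (intro mult_left_mono sum_norm_square_le[OF assms(7) off_diagonal]) (simp_all add: C_def)
  \<comment> \<open>One factor \<open>card W\<close> stays exact and combines with
    \<open>card A\<close> to \<open>(q - 1) ^ r\<close>; only the other one is weakened to a power
    of \<open>q\<close>.\<close>
  also have "\<dots> = real (card A * card W) * (card V + card W * C)"
    by (simp add: power2_eq_square algebra_simps)
  also have "\<dots> \<le> real (card A * card W) * (3 * real q ^ m)"
  proof (intro mult_left_mono)
    have "card W * C \<le> 2 * real q ^ m"
    proof -
      have "(q - 1) ^ (r - m) \<le> q ^ (r - m)" by (intro power_mono) simp_all
      then have "real (card W) \<le> real q ^ (r - m)" unfolding card_W by (metis of_nat_le_iff of_nat_power)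
      \<comment> \<open>The inequality \<open>r \<le> 2 * (2 * m - r)\<close> is the condition
        \<open>3 * r \<le> 4 * m\<close>, which also keeps the subtraction from truncating.\<close>
      moreover have "sqrt (real q ^ r) \<le> real q ^ (2 * m - r)"
      proof (rule real_le_lsqrt)
        have "real q ^ r \<le> real q ^ (2 * (2 * m - r))"
          using m4 q2 by (intro power_increasing) simp_all
        then show "real q ^ r \<le> (real q ^ (2 * m - r))\<^sup>2" by (simp only: power_mult[symmetric] mult.commute[of _ 2])
      qed simp_all
      ultimately have "real (card W) * sqrt (real q ^ r) \<le> real q ^ (r - m) * real q ^ (2 * m - r)"
        by (intro mult_mono) simp_all
      also have "\<dots> = real q ^ m" using m4 m_r by (simp flip: power_add)
      finally show ?thesis by (simp add: C_def assms(4))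
    qed
    then show "card V + card W * C \<le> 3 * real q ^ m" by (simp add: card_V)
  qed simp
  also have "card A * card W = (q - 1) ^ r"
    unfolding card_A card_W using m_r by (simp flip: power_add)
  also have "real ((q - 1) ^ r) * (3 * real q ^ m) =
      (sqrt 3 * (real q - 1) powr (real r / 2) * real q powr (real m / 2))\<^sup>2"
  proof -
    have sq: "(x powr (real n / 2))\<^sup>2 = x ^ n" if "0 < x" for x :: real and n
    proof -
      have "(x powr (real n / 2))\<^sup>2 = x powr (real n / 2 + real n / 2)"
        by (simp only: powr_add power2_eq_square)
      then show ?thesis using that by (simp add: powr_realpow)
    qed
    show ?thesis using q2 by (simp add: power_mult_distrib sq of_nat_diff)
  qed
  finally have "cmod (\<Sum>y\<in>missing_digits \<iota> r \<beta> c. \<chi> y) \<le>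
      sqrt 3 * (real q - 1) powr (real r / 2) * real q powr (real m / 2)"
    by (rule power2_le_imp_le) simp
  then show ?thesis unfolding m_ceil .
qed

end
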